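(* Let $G$ be a topological group, and let $\mathfrak{G}:\mathbb{G}(G)\to\mathbb{G}^*(G)$, $\mathfrak{G}(bG)=\mathrm{cl}(\imath^{bG}_{\Gamma}(G))$, be the map given by the method of graphs. Then: \begin{itemize} \item $\mathfrak{G}$ is a morphism of posets (order-preserving); \item $bG\leq\mathfrak{G}(bG)$ for every $bG\in\mathbb{G}^{\leftrightarrow}(G)$; \item $\mathfrak{G}(bG)\leq b_rG$ for every $bG\in\mathbb{G}(G)$, and if $b_rG\leq bG$, then $\mathfrak{G}(bG)=b_rG$. \end{itemize} Moreover, let $bG\in\mathbb{G}^{\leftrightarrow}(G)$ and let $\mathcal U$ be the subspace uniformity on $G$ as a subset of the compact space $bG$. Then $\mathfrak{G}(bG)=bG$ if and only if for every $u\in\mathcal U$ there exists $v\in\mathcal U$ such that for all $g,h\in G$ with $g\in\mathrm{st}(h,v)$: $$\forall\, y\in G\ \exists\, x\in G\ \text{such that}\ y\in\mathrm{st}(x,u)\ \text{and}\ hy\in\mathrm{st}(gx,u),$$ $$\text{and}\quad \forall\, x\in G\ \exists\, y\in G\ \text{such that}\ x\in\mathrm{st}(y,u)\ \text{and}\ gx\in\mathrm{st}(hy,u).$$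
   Context: All spaces are Tychonoff. A compactification of a space $X$ is a pair $(bX,b)$ with $bX$ compact (Hausdorff) and $b:X\to bX$ a topological embedding with dense image. Write $b'X\geq bX$ if there is a continuous $f:b'X\to bX$ with $b=f\circ b'$; compactifications are identified when each is $\geq$ the other. Let $G$ be a topological group, $\alpha(g,h)=gh$ and $\alpha^*(g,h)=hg^{-1}$ (two left actions of $G$ on itself), and let $*(g)=g^{-1}$ be the involution of $G$. A $G$-compactification of $G$ is a compactification $bG$ (with $G$ identified with its image) to which $\alpha$ extends as a continuous action $\tilde\alpha:G\times bG\to bG$. A $G^{\leftrightarrow}$-compactification is one to which both $\alpha$ and $\alpha^*$ extend as continuous actions. A $G^*$-compactification is a $G$-compactification $bG$ with a continuous map $s:bG\to bG$, $s\circ s=\mathrm{id}$, such that $s|_G=*$. The corresponding posets are $\mathbb{G}(G)$, $\mathbb{G}^{\leftrightarrow}(G)$, $\mathbb{G}^*(G)$; $\mathbb{G}^*(G)\subset\mathbb{G}^{\leftrightarrow}(G)\subset\mathbb{G}(G)$. Uniformities are described by uniform covers. For a cover $u$, $\mathrm{st}(x,u)=\bigcup\{U\in u: x\in U\}$. If $\tilde{\mathcal U}$ is the unique uniformity of the compact space $bG$, the subspace uniformity $\mathcal U$ on $G$ has as a base the covers $\{\tilde U\cap G:\tilde U\in\tilde u\}$, $\tilde u\in\tilde{\mathcal U}$. The Roelcke uniformity $L\wedge R$ on $G$ has as a base the covers $\{OgO: g\in G\}$, $O$ an open neighborhood of the unit. The Roelcke compactification $b_rG$ is the Samuel compactification of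 $(G,L\wedge R)$, i.e. the completion of $G$ with respect to the finest totally bounded uniformity contained in $L\wedge R$. For a compact space $X$, $2^{X\times X}$ is the set of all closed subsets of $X\times X$ (including $\emptyset$) with the Vietoris topology (generated by the sets $\{F\neq\emptyset: F\subset W\}$ and $\{F: F\cap W\ne\emptyset\}$, $W$ open, with $\emptyset$ an isolated point); it is compact. For $bG\in\mathbb{G}(G)$ the map $\imath^{bG}_\Gamma:G\to2^{bG\times bG}$, $\imath^{bG}_\Gamma(g)=\{(x,\tilde\alpha(g,x)):x\in bG\}$, is a topological embedding, and the closure $\mathrm{cl}(\imath^{bG}_\Gamma(G))$ in $2^{bG\times bG}$, with embedding $\imath^{bG}_\Gamma$, is a $G^*$-compactification of $G$ (the self-inverse map being induced by $(x,y)\mapsto(y,x)$); this defines $\mathfrak{G}$. *)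

theory Defs
  imports "HOL-Analysis.Analysis" "HOL-Algebra.Group"
begin

section \<open>Topological groups and their compactifications\<close>

locale topological_group = group G for G (structure) +
  fixes T :: "'g topology"
  assumes topspace_eq: "topspace T = carrier G"
    and continuous_mult: "continuous_map (prod_topology T T) T (\<lambda>(x, y). x \<otimes> y)"
    and continuous_inv: "continuous_map T T (\<lambda>x. inv x)"
    and tychonoff: "completely_regular_space T" "Hausdorff_space T"

text \<open>
  A compactification is a pair \<open>(X, b)\<close> of a compact Hausdorff space and a dense embedding.
  Compactifications are compared only through \<open>comp_le\<close>, and are identified by \<open>comp_eq\<close>.
\<close>

type_synonym ('g, 'b) compactification = "'b topology \<times> ('g \<Rightarrow> 'b)"

definition compactification :: "'g topology \<Rightarrow> ('g, 'b) compactification \<Rightarrow> bool" where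
  "compactification T C \<longleftrightarrow>
     (case C of (X, b) \<Rightarrow>
        compact_space X \<and> Hausdorff_space X \<and> embedding_map T X b \<and>
        Abstract_Topology.closure_of X (b ` topspace T) = topspace X)"

definition comp_le ::
    "'g topology \<Rightarrow> ('g, 'b) compactification \<Rightarrow> ('g, 'c) compactification \<Rightarrow> bool" where
  "comp_le T C C' \<longleftrightarrow>
     (case C of (X, b) \<Rightarrow> case C' of (X', b') \<Rightarrow>
        \<exists>f. continuous_map X' X f \<and> (\<forall>x\<in>topspace T. b x = f (b' x)))"

definition comp_eq ::
    "'g topology \<Rightarrow> ('g, 'b) compactification \<Rightarrow> ('g, 'c) compactification \<Rightarrow> bool" where
  "comp_eq T C C' \<longleftrightarrow> comp_le T C C' \<and> comp_le T C' C"


section \<open>Equivariant compactifications\<close>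

definition continuous_action ::
    "('g, 'm) monoid_scheme \<Rightarrow> 'g topology \<Rightarrow> 'b topology \<Rightarrow> ('g \<Rightarrow> 'b \<Rightarrow> 'b) \<Rightarrow> bool" where
  "continuous_action G T X a \<longleftrightarrow>
     continuous_map (prod_topology T X) X (\<lambda>(g, x). a g x) \<and>
     (\<forall>x\<in>topspace X. a \<one>\<^bsub>G\<^esub> x = x) \<and>
     (\<forall>g\<in>carrier G. \<forall>h\<in>carrier G. \<forall>x\<in>topspace X. a (g \<otimes>\<^bsub>G\<^esub> h) x = a g (a h x))"

definition left_act :: "('g, 'm) monoid_scheme \<Rightarrow> 'g \<Rightarrow> 'g \<Rightarrow> 'g" where
  "left_act G g h = g \<otimes>\<^bsub>G\<^esub> h"

definition right_act :: "('g, 'm) monoid_scheme \<Rightarrow> 'g \<Rightarrow> 'g \<Rightarrow> 'g" where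
  "right_act G g h = h \<otimes>\<^bsub>G\<^esub> inv\<^bsub>G\<^esub> g"

definition action_extension ::
    "('g, 'm) monoid_scheme \<Rightarrow> 'g topology \<Rightarrow> ('g \<Rightarrow> 'g \<Rightarrow> 'g) \<Rightarrow>
     ('g, 'b) compactification \<Rightarrow> ('g \<Rightarrow> 'b \<Rightarrow> 'b) \<Rightarrow> bool" where
  "action_extension G T act C a \<longleftrightarrow>
     (case C of (X, b) \<Rightarrow>
        continuous_action G T X a \<and>
        (\<forall>g\<in>carrier G. \<forall>h\<in>carrier G. a g (b h) = b (act g h)))"

definition G_compactification ::
    "('g, 'm) monoid_scheme \<Rightarrow> 'g topology \<Rightarrow> ('g, 'b) compactification \<Rightarrow> bool" where
  "G_compactification G T C \<longleftrightarrow>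
     compactification T C \<and> (\<exists>a. action_extension G T (left_act G) C a)"

definition G_lr_compactification ::
    "('g, 'm) monoid_scheme \<Rightarrow> 'g topology \<Rightarrow> ('g, 'b) compactification \<Rightarrow> bool" where
  "G_lr_compactification G T C \<longleftrightarrow>
     compactification T C \<and>
     (\<exists>a. action_extension G T (left_act G) C a) \<and>
     (\<exists>a. action_extension G T (right_act G) C a)"

definition G_star_compactification ::
    "('g, 'm) monoid_scheme \<Rightarrow> 'g topology \<Rightarrow> ('g, 'b) compactification \<Rightarrow> bool" where
  "G_star_compactification G T C \<longleftrightarrow>
     G_compactification G T C \<and>
     (case C of (X, b) \<Rightarrow>
        \<exists>s. continuous_map X X s \<and> (\<forall>x\<in>topspace X. s (s x) = x) \<and>
            (\<forall>g\<in>carrier G. s (b g) = b (inv\<^bsub>G\<^esub> g)))"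


section \<open>The method of graphs\<close>

text \<open>
  The hyperspace of all closed subsets, including the empty set; \<open>{{}}\<close> in the subbase makes
  the empty set an isolated point.
\<close>

definition vietoris :: "'a topology \<Rightarrow> 'a set topology" where
  "vietoris X = topology_generated_by
     ({{F. closedin X F \<and> F \<noteq> {} \<and> F \<subseteq> W} | W. openin X W} \<union>
      {{F. closedin X F \<and> F \<inter> W \<noteq> {}} | W. openin X W} \<union>
      {{{}}})"

text \<open>
  By density of the image and the Hausdorff property, the extended action is unique on
  \<open>carrier G \<times> topspace X\<close>, so that the choice below is immaterial.
\<close>

definition extended_action ::
    "('g, 'm) monoid_scheme \<Rightarrow> 'g topology \<Rightarrow> ('g, 'b) compactification \<Rightarrow> 'g \<Rightarrow> 'b \<Rightarrow> 'b" where
  "extended_action G T C = (SOME a. action_extension G T (left_act G) C a)"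

definition graph_map ::
    "('g, 'm) monoid_scheme \<Rightarrow> 'g topology \<Rightarrow> ('g, 'b) compactification \<Rightarrow> 'g \<Rightarrow> ('b \<times> 'b) set" where
  "graph_map G T C g = {(x, extended_action G T C g x) | x. x \<in> topspace (fst C)}"

definition graph_compactification ::
    "('g, 'm) monoid_scheme \<Rightarrow> 'g topology \<Rightarrow> ('g, 'b) compactification \<Rightarrow>
     ('g, ('b \<times> 'b) set) compactification" where
  "graph_compactification G T C =
     (let V = vietoris (prod_topology (fst C) (fst C)) in
      (subtopology V (Abstract_Topology.closure_of V (graph_map G T C ` carrier G)),
       graph_map G T C))"


section \<open>Uniformities given by uniform covers\<close>

definition is_cover :: "'a set \<Rightarrow> 'a set set \<Rightarrow> bool" where
  "is_cover S u \<longleftrightarrow> \<Union>u = S"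

definition star :: "'a \<Rightarrow> 'a set set \<Rightarrow> 'a set" where
  "star x u = \<Union>{U \<in> u. x \<in> U}"

definition refines :: "'a set set \<Rightarrow> 'a set set \<Rightarrow> bool" where
  "refines v u \<longleftrightarrow> (\<forall>V\<in>v. \<exists>U\<in>u. V \<subseteq> U)"

definition star_refines :: "'a set set \<Rightarrow> 'a set set \<Rightarrow> bool" where
  "star_refines v u \<longleftrightarrow> (\<forall>V\<in>v. \<exists>U\<in>u. \<Union>{V' \<in> v. V' \<inter> V \<noteq> {}} \<subseteq> U)"

definition cover_uniformity :: "'a set \<Rightarrow> 'a set set set \<Rightarrow> bool" where
  "cover_uniformity S \<U> \<longleftrightarrow>
     \<U> \<noteq> {} \<and> (\<forall>u\<in>\<U>. is_cover S u) \<and>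
     (\<forall>u\<in>\<U>. \<forall>v. is_cover S v \<and> refines u v \<longrightarrow> v \<in> \<U>) \<and>
     (\<forall>u\<in>\<U>. \<forall>v\<in>\<U>. \<exists>w\<in>\<U>. star_refines w u \<and> star_refines w v)"

definition covers_generated_by :: "'a set \<Rightarrow> 'a set set set \<Rightarrow> 'a set set set" where
  "covers_generated_by S B = {v. is_cover S v \<and> (\<exists>u\<in>B. refines u v)}"

text \<open>
  Separatedness is not part of \<open>cover_uniformity\<close>; it is automatic for a uniformity that induces
  a Hausdorff topology.
\<close>

definition induces_topology :: "'a set set set \<Rightarrow> 'a topology \<Rightarrow> bool" where
  "induces_topology \<U> X \<longleftrightarrow>
     (\<forall>W. openin X W \<longleftrightarrow> W \<subseteq> topspace X \<and> (\<forall>x\<in>W. \<exists>u\<in>\<U>. star x u \<subseteq> W))"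

definition compact_uniformity :: "'a topology \<Rightarrow> 'a set set set" where
  "compact_uniformity X = (THE \<U>. cover_uniformity (topspace X) \<U> \<and> induces_topology \<U> X)"

text \<open>The trace of a uniformity along a map \<open>b\<close> defined on \<open>S\<close>, which plays the role of an inclusion.\<close>

definition trace_uniformity :: "'g set \<Rightarrow> ('g \<Rightarrow> 'b) \<Rightarrow> 'b set set set \<Rightarrow> 'g set set set" where
  "trace_uniformity S b \<W> = covers_generated_by S {{b -` W \<inter> S | W. W \<in> w} | w. w \<in> \<W>}"

definition subspace_uniformity ::
    "('g, 'm) monoid_scheme \<Rightarrow> ('g, 'b) compactification \<Rightarrow> 'g set set set" where
  "subspace_uniformity G C =
     (case C of (X, b) \<Rightarrow> trace_uniformity (carrier G) b (compact_uniformity X))"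


section \<open>The Roelcke compactification\<close>

definition roelcke_uniformity ::
    "('g, 'm) monoid_scheme \<Rightarrow> 'g topology \<Rightarrow> 'g set set set" where
  "roelcke_uniformity G T =
     covers_generated_by (carrier G)
       {{{x \<otimes>\<^bsub>G\<^esub> g \<otimes>\<^bsub>G\<^esub> y | x y. x \<in> N \<and> y \<in> N} | g. g \<in> carrier G} |
          N. openin T N \<and> \<one>\<^bsub>G\<^esub> \<in> N}"

definition totally_bounded_uniformity :: "'a set \<Rightarrow> 'a set set set \<Rightarrow> bool" where
  "totally_bounded_uniformity S \<U> \<longleftrightarrow>
     cover_uniformity S \<U> \<and> (\<forall>u\<in>\<U>. \<exists>v\<subseteq>u. finite v \<and> is_cover S v)"

text \<open>Finer uniformities have more uniform covers.\<close>

definition finest_totally_bounded_in ::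
    "'a set \<Rightarrow> 'a set set set \<Rightarrow> 'a set set set \<Rightarrow> bool" where
  "finest_totally_bounded_in S \<U> \<V> \<longleftrightarrow>
     totally_bounded_uniformity S \<V> \<and> \<V> \<subseteq> \<U> \<and>
     (\<forall>\<W>. totally_bounded_uniformity S \<W> \<and> \<W> \<subseteq> \<U> \<longrightarrow> \<W> \<subseteq> \<V>)"

definition complete_uniformity :: "'a set \<Rightarrow> 'a set set set \<Rightarrow> bool" where
  "complete_uniformity S \<U> \<longleftrightarrow>
     cover_uniformity S \<U> \<and>
     (\<forall>F. F \<noteq> bot \<and> F \<le> principal S \<and> (\<forall>u\<in>\<U>. \<exists>U\<in>u. eventually (\<lambda>y. y \<in> U) F) \<longrightarrow>
          (\<exists>x\<in>S. \<forall>u\<in>\<U>. eventually (\<lambda>y. y \<in> star x u) F))"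

text \<open>
  The completion is characterised up to isomorphism: a complete Hausdorff uniform space with an
  embedding of \<open>(S, \<V>)\<close> onto a dense subspace (density is part of \<open>compactification\<close>). Hence the
  Roelcke compactification is a predicate, satisfied by every model of the completion that is
  a compactification; its uniformity is the unique one of the compact space.
\<close>

definition roelcke_compactification ::
    "('g, 'm) monoid_scheme \<Rightarrow> 'g topology \<Rightarrow> ('g, 'b) compactification \<Rightarrow> bool" where
  "roelcke_compactification G T R \<longleftrightarrow>
     compactification T R \<and>
     complete_uniformity (topspace (fst R)) (compact_uniformity (fst R)) \<and>
     finest_totally_bounded_in (carrier G) (roelcke_uniformity G T) (subspace_uniformity G R)"

end

theory Submission
  imports Defs
begin

text \<open>
  Write \<open>K\<close> for the closure of the graphs in the hyperspace. A limit \<open>F \<in> K\<close> of graphs is compared with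
  a point of the original compactification through its fibre \<open>{y. (b \<one>, y) \<in> F}\<close>: every graph has
  the single point \<open>b g\<close> there, and the fibre of a limit consists of limits of \<open>b (g\<^sub>i \<otimes> k\<^sub>i)\<close> with
  \<open>k\<^sub>i \<rightarrow> \<one>\<close>. Joint continuity of the right action at \<open>\<one>\<close> makes it a singleton, whence
  \<open>bG \<le> K\<close>; a map to the Roelcke compactification is at least constant on it, because its uniform
  covers do not distinguish \<open>g \<otimes> k\<close> from \<open>g \<otimes> k'\<close> for small \<open>k\<close>, \<open>k'\<close>. Conversely \<open>K\<close> carries both
  actions, and by compactness both move all its points uniformly little near \<open>\<one>\<close>, so that its
  uniformity lies below the Roelcke uniformity. Finally, the Vietoris topology on \<open>K\<close> is induced by
  uniform closeness of graphs, and since \<open>b(G)\<close> is dense this can be tested on the points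
  \<open>(b y, b (h \<otimes> y))\<close>; the condition of the theorem says that \<open>b g \<mapsto> graph g\<close> is uniformly
  continuous.
\<close>

section \<open>The Vietoris hyperspace\<close>

text \<open>A limit of graphs is only a closed relation, so values cannot be read off it by
  evaluation, and nothing is gained by extending maps from \<open>G\<close> abstractly. Apart from
  monotonicity, where a map of the spaces induces a map of the hyperspaces, each comparison map that
  is built comes from one kind of statement: two distinct target points have neighbourhoods that
  elements of \<open>G\<close> lying close together in the source cannot enter separately.
  Compactness turns this into a single-valued closed relation, that is, into a continuous map.

  The uniformities must be put into the same language. Since \<open>compact_uniformity\<close> is a
  definite description, it is first shown to consist exactly of the covers refined by open covers;
  then the trace on \<open>G\<close> is governed by traces of open covers.

  The bound by the Roelcke compactification needs both actions, but only the left one is built on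
  \<open>K\<close>. The right one comes for free: swapping coordinates extends inversion, and
  inversion conjugates left into right translations.

  The two halves of the final criterion differ by exchanging \<open>g\<close> and \<open>h\<close>.
  Stars are symmetric, so one half for all close pairs already gives the other, and only one-sided
  closeness of graphs is studied.\<close>

lemma openin_prod_topologyE:
  assumes "openin (prod_topology X Y) P" "(x, y) \<in> P"
  obtains A B where "openin X A" "openin Y B" "x \<in> A" "y \<in> B" "A \<times> B \<subseteq> P"
  using assms(1)[unfolded openin_prod_topology_alt, rule_format, OF assms(2)] by auto

lemma topspace_vietoris: "topspace (vietoris X) = {F. closedin X F}"
proof -
  have "F \<in> topspace (vietoris X)" if "closedin X F" for F
  proof -
    let ?A = "{F. closedin X F \<and> F \<noteq> {} \<and> F \<subseteq> topspace X}"
    have "F \<in> \<Union>{?A, {{}}}"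
      using that closedin_subset by auto
    also have "\<dots> \<subseteq> topspace (vietoris X)"
      unfolding vietoris_def topology_generated_by_topspace
      using openin_topspace[of X] by (intro Union_mono) auto
    finally show ?thesis .
  qed
  then show ?thesis
    unfolding vietoris_def topology_generated_by_topspace by auto
qed

lemma openin_vietoris_subset:
  assumes "openin X W"
  shows "openin (vietoris X) {F. closedin X F \<and> F \<subseteq> W}"
proof -
  have "openin (vietoris X) ({F. closedin X F \<and> F \<noteq> {} \<and> F \<subseteq> W} \<union> {{}})"
    unfolding vietoris_def using assms
    by (intro openin_Un topology_generated_by_Basis) auto
  also have "{F. closedin X F \<and> F \<noteq> {} \<and> F \<subseteq> W} \<union> {{}} = {F. closedin X F \<and> F \<subseteq> W}"
    by auto
  finally show ?thesis .
qed

lemma openin_vietoris_hit: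
  assumes "openin X W"
  shows "openin (vietoris X) {F. closedin X F \<and> F \<inter> W \<noteq> {}}"
  unfolding vietoris_def using assms by (intro topology_generated_by_Basis) auto

text \<open>The complement consists of the closed sets inside an open set. Hitting a closed set thus
  survives limits, which gives every member of \<open>K\<close> a nonempty fibre.\<close>

lemma closedin_vietoris_hit:
  assumes "closedin X A"
  shows "closedin (vietoris X) {F. closedin X F \<and> F \<inter> A \<noteq> {}}"
proof -
  have "openin (vietoris X) {F. closedin X F \<and> F \<subseteq> topspace X - A}"
    using assms by (intro openin_vietoris_subset) (rule openin_diff[OF openin_topspace])
  moreover have "topspace (vietoris X) - {F. closedin X F \<and> F \<inter> A \<noteq> {}} =
      {F. closedin X F \<and> F \<subseteq> topspace X - A}"
    unfolding topspace_vietoris using closedin_subset by fastforce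
  ultimately show ?thesis unfolding closedin_def topspace_vietoris by auto
qed

text \<open>Two conditions suffice for three kinds of subbasic sets: being nonempty is hitting the
  whole space, and being empty is lying inside the open set \<open>{}\<close>.\<close>

lemma continuous_map_into_vietoris:
  assumes cl: "\<And>z. z \<in> topspace Z \<Longrightarrow> closedin X (f z)"
    and inside: "\<And>W. openin X W \<Longrightarrow> openin Z {z \<in> topspace Z. f z \<subseteq> W}"
    and hit: "\<And>W. openin X W \<Longrightarrow> openin Z {z \<in> topspace Z. f z \<inter> W \<noteq> {}}"
  shows "continuous_map Z (vietoris X) f"
  unfolding vietoris_def
proof (rule continuous_on_generated_topo)
  show "f ` topspace Z \<subseteq> \<Union> ({{F. closedin X F \<and> F \<noteq> {} \<and> F \<subseteq> W} |W. openin X W} \<union>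
      {{F. closedin X F \<and> F \<inter> W \<noteq> {}} |W. openin X W} \<union> {{{}}})"
    using cl topspace_vietoris[of X] unfolding vietoris_def topology_generated_by_topspace by blast
next
  fix U assume "U \<in> {{F. closedin X F \<and> F \<noteq> {} \<and> F \<subseteq> W} |W. openin X W} \<union>
      {{F. closedin X F \<and> F \<inter> W \<noteq> {}} |W. openin X W} \<union> {{{}}}"
  then consider W where "openin X W" "U = {F. closedin X F \<and> F \<noteq> {} \<and> F \<subseteq> W}"
    | W where "openin X W" "U = {F. closedin X F \<and> F \<inter> W \<noteq> {}}" | "U = {{}}"
    by blast
  then show "openin Z (f -` U \<inter> topspace Z)"
  proof cases
    case (1 W)
    have "f -` U \<inter> topspace Z =
        {z \<in> topspace Z. f z \<subseteq> W} \<inter> {z \<in> topspace Z. f z \<inter> topspace X \<noteq> {}}"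
      using cl 1 closedin_subset by fastforce
    then show ?thesis using inside[OF 1(1)] hit[OF openin_topspace] by auto
  next
    case (2 W)
    then have "f -` U \<inter> topspace Z = {z \<in> topspace Z. f z \<inter> W \<noteq> {}}"
      using cl by auto
    then show ?thesis using hit[OF 2(1)] by auto
  next
    case 3
    then have "f -` U \<inter> topspace Z = {z \<in> topspace Z. f z \<subseteq> {}}"
      by auto
    then show ?thesis using inside[OF openin_empty] by auto
  qed
qed

text \<open>Regularity separates a point of one closed set from the other closed set that misses it;
  hitting the first neighbourhood then excludes lying inside the second.\<close>

lemma Hausdorff_space_vietoris:
  assumes "regular_space X"
  shows "Hausdorff_space (vietoris X)"
proof -
  have sep: "\<exists>U V. openin (vietoris X) U \<and> openin (vietoris X) V \<and> F \<in> U \<and> F' \<in> V \<and> disjnt U V"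
    if F: "closedin X F" and F': "closedin X F'" and x: "x \<in> F" "x \<notin> F'" for F F' x
  proof -
    obtain U V where UV: "openin X U" "openin X V" "x \<in> U" "F' \<subseteq> V" "disjnt U V"
      using assms F' x closedin_subset[OF F] unfolding regular_space_def by (meson DiffI subsetD)
    let ?A = "{F. closedin X F \<and> F \<inter> U \<noteq> {}}"
    let ?B = "{F. closedin X F \<and> F \<subseteq> V}"
    have "openin (vietoris X) ?A" "openin (vietoris X) ?B"
      using openin_vietoris_hit openin_vietoris_subset UV by blast+
    moreover have "F \<in> ?A" "F' \<in> ?B" "disjnt ?A ?B"
      using F F' x UV by (auto simp: disjnt_def)
    ultimately show ?thesis by blast
  qed
  show ?thesis
    unfolding Hausdorff_space_def topspace_vietoris
  proof clarify
    fix F F' assume F: "closedin X F" "closedin X F'" "F \<noteq> F'"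
    then consider x where "x \<in> F" "x \<notin> F'" | x where "x \<in> F'" "x \<notin> F" by blast
    then show "\<exists>U V. openin (vietoris X) U \<and> openin (vietoris X) V \<and> F \<in> U \<and> F' \<in> V \<and> disjnt U V"
    proof cases
      case 1 then show ?thesis using sep[OF F(1,2)] by blast
    next
      case 2
      then obtain U V where "openin (vietoris X) U" "openin (vietoris X) V" "F' \<in> U" "F \<in> V"
          "disjnt U V"
        using sep[OF F(2,1)] by blast
      then show ?thesis using disjnt_sym[of U V] by blast
    qed
  qed
qed

text \<open>Connects the inductively generated topology with the unions of finite intersections in
  which Alexander's subbase theorem is phrased.\<close>

lemma topology_generated_by_eq_subbase:
  "topology_generated_by \<S> =
     topology (arbitrary union_of (finite intersection_of (\<lambda>x. x \<in> \<S>) relative_to \<Union>\<S>))"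
    (is "_ = topology ?T")
proof -
  have T: "openin (topology ?T) = ?T"
    using istopology_subbase topology_inverse' by blast
  have "openin (topology ?T) U" if "generate_topology_on \<S> U" for U
    using that
  proof induction
    case (Basis s)
    have "(finite intersection_of (\<lambda>x. x \<in> \<S>)) s"
      using Basis by (simp add: finite_intersection_of_inc)
    then have "(finite intersection_of (\<lambda>x. x \<in> \<S>) relative_to \<Union>\<S>) (\<Union>\<S> \<inter> s)"
      by (simp add: relative_to_inc)
    moreover have "\<Union>\<S> \<inter> s = s" using Basis by auto
    ultimately show ?case by (simp add: T arbitrary_union_of_inc)
  qed auto
  moreover have "openin (topology_generated_by \<S>) U" if "?T U" for U
  proof -
    obtain \<U> where \<U>: "\<U> \<subseteq> Collect (finite intersection_of (\<lambda>x. x \<in> \<S>) relative_to \<Union>\<S>)"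
        "\<Union>\<U> = U"
      using \<open>?T U\<close> unfolding union_of_def by auto
    have "openin (topology_generated_by \<S>) V" if V: "V \<in> \<U>" for V
    proof -
      obtain \<V> where \<V>: "\<V> \<subseteq> \<S>" "finite \<V>" "V = \<Union>\<S> \<inter> \<Inter>\<V>"
        using \<U>(1) V unfolding relative_to_def intersection_of_def by blast
      \<comment> \<open>Inserting the whole space keeps the family nonempty when no subbasic set is
        intersected.\<close>
      have "V = \<Inter>(insert (\<Union>\<S>) \<V>)" using \<V> by auto
      moreover have "openin (topology_generated_by \<S>) (\<Union>\<S>)"
        using openin_topspace[of "topology_generated_by \<S>"] by simp
      ultimately show ?thesis using \<V> topology_generated_by_Basis
        by (metis (no_types, lifting) finite_insert insertE insert_not_empty openin_Inter subsetD)
    qed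
    then show ?thesis using \<U>(2) by blast
  qed
  ultimately show ?thesis
    by (metis T openin_topology_generated_by topology_eq)
qed

text \<open>By Alexander's theorem only covers by subbasic sets matter. A closed set avoiding all
  hitting members of the cover lies in a member that merely asks for inclusion in an open
  \<open>W\<close>; what sticks out of \<open>W\<close> falls into a compact set, and finitely many
  hitting members take care of it.\<close>

lemma compact_space_vietoris:
  assumes X: "compact_space X"
  shows "compact_space (vietoris X)"
proof -
  let ?in = "\<lambda>W. {F. closedin X F \<and> F \<noteq> {} \<and> F \<subseteq> W}"
  let ?hit = "\<lambda>W. {F. closedin X F \<and> F \<inter> W \<noteq> {}}"
  define \<S> where "\<S> = {?in W | W. openin X W} \<union> {?hit W | W. openin X W} \<union> {{{}}}"
  have V: "vietoris X = topology_generated_by \<S>" unfolding vietoris_def \<S>_def ..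
  show ?thesis
  proof (rule Alexander_subbase[where \<B> = \<S>])
    show "topology (arbitrary union_of (finite intersection_of (\<lambda>x. x \<in> \<S>) relative_to \<Union>\<S>)) =
        vietoris X"
      by (simp add: V topology_generated_by_eq_subbase)
  next
    fix \<C> assume \<C>: "\<C> \<subseteq> \<S>" "\<Union>\<C> = topspace (vietoris X)"
    define \<H> where "\<H> = {W. openin X W \<and> ?hit W \<in> \<C>}"
    \<comment> \<open>The largest closed set that belongs to no hitting member of the cover. The
      member that contains it must therefore be an inclusion set or \<open>{{}}\<close>; in the
      latter case \<open>W\<close> is empty.\<close>
    define F0 where "F0 = topspace X - \<Union>\<H>"
    have F0: "closedin X F0" unfolding F0_def \<H>_def by (intro closedin_diff) auto
    have "F0 \<in> \<Union>\<C>" "{} \<in> \<Union>\<C>"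
      unfolding \<C>(2) topspace_vietoris using F0 by simp_all
    then obtain C D where C: "C \<in> \<C>" "F0 \<in> C" and D: "D \<in> \<C>" "{} \<in> D"
      by blast
    have "C \<in> \<S>" using C \<C> by blast
    then obtain W where W: "openin X W" "F0 \<subseteq> W" "?in W \<subseteq> C"
    proof -
      consider W where "openin X W" "C = ?in W" | W where "openin X W" "C = ?hit W" | "C = {{}}"
        using \<open>C \<in> \<S>\<close> unfolding \<S>_def by blast
      then show thesis
      proof cases
        case 1 then show thesis using that C by blast
      next
        case 2
        then have "W \<in> \<H>" using C unfolding \<H>_def by blast
        then have "F0 \<inter> W = {}" unfolding F0_def by blast
        then show thesis using 2 C by blast
      next
        case 3 then show thesis using that[of "{}"] C by auto
      qed
    qed
    have "compactin X (topspace X - W)"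
      using X W by (simp add: closedin_compact_space closedin_diff)
    moreover have "topspace X - W \<subseteq> \<Union>\<H>" using W unfolding F0_def by blast
    ultimately obtain \<F> where \<F>: "finite \<F>" "\<F> \<subseteq> \<H>" "topspace X - W \<subseteq> \<Union>\<F>"
      using compactinD[of X "topspace X - W" \<H>] unfolding \<H>_def by blast
    \<comment> \<open>\<open>D\<close> is kept for the empty set, which \<open>?in W\<close> leaves
      out.\<close>
    let ?\<C>' = "insert C (insert D (?hit ` \<F>))"
    have sub: "?\<C>' \<subseteq> \<C>" using C D \<F> unfolding \<H>_def by blast
    have "F \<in> \<Union>?\<C>'" if F: "closedin X F" for F
    proof (cases "F = {} \<or> F \<subseteq> W")
      case True
      then have "F \<in> D \<or> F \<in> C" using D W(3) F by auto
      then show ?thesis by blast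
    next
      case False
      then obtain x where "x \<in> F" "x \<notin> W" by blast
      moreover have "x \<in> topspace X" using \<open>x \<in> F\<close> F closedin_subset by blast
      ultimately obtain H where "H \<in> \<F>" "x \<in> H" using \<F> by blast
      then have "F \<in> ?hit H" using \<open>x \<in> F\<close> F by blast
      then show ?thesis using \<open>H \<in> \<F>\<close> by blast
    qed
    then have "topspace (vietoris X) \<subseteq> \<Union>?\<C>'" unfolding topspace_vietoris by blast
    then have "\<Union>?\<C>' = topspace (vietoris X)"
      using Union_mono[OF sub] unfolding \<C>(2) by (intro subset_antisym)
    moreover have "finite ?\<C>'" using \<F> by blast
    ultimately show "\<exists>\<C>'. finite \<C>' \<and> \<C>' \<subseteq> \<C> \<and> \<Union>\<C>' = topspace (vietoris X)"
      using sub by blast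
  qed
qed

text \<open>The parameter \<open>g\<close> is carried along because the action on the hyperspace has
  to be jointly continuous. It also yields continuity of the graph map, by fixing \<open>F\<close>
  to be the whole space.\<close>

lemma continuous_map_vietoris_image:
  assumes X: "compact_space X" and Y: "Hausdorff_space Y"
    and a: "continuous_map (prod_topology T X) Y (\<lambda>(g, x). a g x)"
  shows "continuous_map (prod_topology T (vietoris X)) (vietoris Y) (\<lambda>(g, F). a g ` F)"
proof (rule continuous_map_into_vietoris)
  have slice: "continuous_map X Y (a g)" if "g \<in> topspace T" for g
  proof -
    have "continuous_map X (prod_topology T X) (\<lambda>x. (g, x))"
      using that by (simp add: continuous_map_paired)
    then have "continuous_map X Y ((\<lambda>(g, x). a g x) \<circ> (\<lambda>x. (g, x)))"
      using a continuous_map_compose by blast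
    then show ?thesis by (simp add: o_def)
  qed
  fix z assume "z \<in> topspace (prod_topology T (vietoris X))"
  then obtain g F where z: "z = (g, F)" "g \<in> topspace T" "closedin X F"
    by (auto simp: topspace_vietoris)
  then have "closedin Y (a g ` F)"
    using continuous_imp_closed_map[OF slice X Y] by (simp add: closed_map_def)
  then show "closedin Y (case z of (g, F) \<Rightarrow> a g ` F)" using z by simp
next
  fix W assume W: "openin Y W"
  define P where "P = {p \<in> topspace (prod_topology T X). (case p of (g, x) \<Rightarrow> a g x) \<in> W}"
  have P: "openin (prod_topology T X) P"
    unfolding P_def using a W by (rule openin_continuous_map_preimage)
  show "openin (prod_topology T (vietoris X))
      {z \<in> topspace (prod_topology T (vietoris X)). (case z of (g, F) \<Rightarrow> a g ` F) \<subseteq> W}"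
    unfolding openin_prod_topology_alt
  proof (intro allI impI)
    fix g F assume "(g, F) \<in> {z \<in> topspace (prod_topology T (vietoris X)).
        (case z of (g, F) \<Rightarrow> a g ` F) \<subseteq> W}"
    then have gF: "g \<in> topspace T" "closedin X F" "a g ` F \<subseteq> W" by (auto simp: topspace_vietoris)
    have "{g} \<times> F \<subseteq> P" using gF closedin_subset unfolding P_def by fastforce
    \<comment> \<open>Wallace's theorem gives one neighbourhood of \<open>g\<close> that works for
      all points of the compact set \<open>F\<close> at once.\<close>
    moreover have "compactin T {g}" "compactin X F"
      using gF X by (auto simp: closedin_compact_space)
    ultimately obtain N V where NV: "openin T N" "openin X V" "g \<in> N" "F \<subseteq> V" "N \<times> V \<subseteq> P"
      using Wallace_theorem_prod_topology[OF _ _ P] by (metis insert_subset)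
    have "N \<times> {F. closedin X F \<and> F \<subseteq> V} \<subseteq> {z \<in> topspace (prod_topology T (vietoris X)).
        (case z of (g, F) \<Rightarrow> a g ` F) \<subseteq> W}"
      using NV openin_subset[OF NV(1)] unfolding P_def by (fastforce simp: topspace_vietoris)
    then show "\<exists>U V. openin T U \<and> openin (vietoris X) V \<and> g \<in> U \<and> F \<in> V \<and>
        U \<times> V \<subseteq> {z \<in> topspace (prod_topology T (vietoris X)). (case z of (g, F) \<Rightarrow> a g ` F) \<subseteq> W}"
      using NV gF openin_vietoris_subset[OF NV(2)]
      by (intro exI[of _ N] exI[of _ "{F. closedin X F \<and> F \<subseteq> V}"]) simp
  qed
  show "openin (prod_topology T (vietoris X))
      {z \<in> topspace (prod_topology T (vietoris X)). (case z of (g, F) \<Rightarrow> a g ` F) \<inter> W \<noteq> {}}"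
    unfolding openin_prod_topology_alt
  proof (intro allI impI)
    fix g F assume "(g, F) \<in> {z \<in> topspace (prod_topology T (vietoris X)).
        (case z of (g, F) \<Rightarrow> a g ` F) \<inter> W \<noteq> {}}"
    then obtain x where gF: "g \<in> topspace T" "closedin X F" "x \<in> F" "a g x \<in> W"
      by (auto simp: topspace_vietoris)
    then have "(g, x) \<in> P" using closedin_subset unfolding P_def by fastforce
    from P[unfolded openin_prod_topology_alt, rule_format, OF this]
    obtain N V where NV: "openin T N" "openin X V" "g \<in> N" "x \<in> V" "N \<times> V \<subseteq> P"
      by auto
    have "N \<times> {F. closedin X F \<and> F \<inter> V \<noteq> {}} \<subseteq> {z \<in> topspace (prod_topology T (vietoris X)).
        (case z of (g, F) \<Rightarrow> a g ` F) \<inter> W \<noteq> {}}"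
      using NV openin_subset[OF NV(1)] unfolding P_def by (fastforce simp: topspace_vietoris)
    then show "\<exists>U V. openin T U \<and> openin (vietoris X) V \<and> g \<in> U \<and> F \<in> V \<and>
        U \<times> V \<subseteq> {z \<in> topspace (prod_topology T (vietoris X)). (case z of (g, F) \<Rightarrow> a g ` F) \<inter> W \<noteq> {}}"
      using NV gF openin_vietoris_hit[OF NV(2)]
      by (intro exI[of _ N] exI[of _ "{F. closedin X F \<and> F \<inter> V \<noteq> {}}"]) auto
  qed
qed

corollary continuous_map_vietoris_image_fixed:
  assumes "compact_space X" and "Hausdorff_space Y" and f: "continuous_map X Y f"
  shows "continuous_map (vietoris X) (vietoris Y) ((`) f)"
proof -
  let ?T = "discrete_topology {()}"
  have "f \<circ> snd = (\<lambda>(g :: unit, x). f x)"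
    by (simp add: fun_eq_iff)
  then have "continuous_map (prod_topology ?T X) Y (\<lambda>(g, x). f x)"
    using continuous_map_compose[OF continuous_map_snd[of ?T X] f] by simp
  then have "continuous_map (prod_topology ?T (vietoris X)) (vietoris Y) (\<lambda>(g, F). f ` F)"
    using continuous_map_vietoris_image[OF assms(1,2)] by blast
  moreover have "continuous_map (vietoris X) (prod_topology ?T (vietoris X)) (\<lambda>F. ((), F))"
    by (simp add: continuous_map_paired)
  ultimately have "continuous_map (vietoris X) (vietoris Y) ((\<lambda>(g, F). f ` F) \<circ> (\<lambda>F. ((), F)))"
    using continuous_map_compose by blast
  then show ?thesis by (simp add: o_def)
qed

section \<open>Uniform covers of compact spaces\<close>

definition open_cover :: "'a topology \<Rightarrow> 'a set set \<Rightarrow> bool" where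
  "open_cover X w \<longleftrightarrow> (\<forall>W\<in>w. openin X W) \<and> \<Union>w = topspace X"

text \<open>The explicit form of the unique uniformity of a nonempty compact Hausdorff space: there
  every open cover is uniform.\<close>

definition open_cover_uniformity :: "'a topology \<Rightarrow> 'a set set set" where
  "open_cover_uniformity X = covers_generated_by (topspace X) {w. open_cover X w}"

section \<open>Refinements, stars and star refinements\<close>

lemma refines_refl [simp]: "refines u u"
  unfolding refines_def by blast

lemma refines_trans: "refines u v \<Longrightarrow> refines v w \<Longrightarrow> refines u w"
  unfolding refines_def by (meson subset_trans)

lemma star_refines_mono:
  assumes "star_refines w u" "refines u v"
  shows "star_refines w v"
  unfolding star_refines_def
proof
  fix W assume "W \<in> w"
  then obtain U where U: "U \<in> u" "\<Union>{V \<in> w. V \<inter> W \<noteq> {}} \<subseteq> U"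
    using assms(1) unfolding star_refines_def by auto
  then obtain V where "V \<in> v" "U \<subseteq> V"
    using assms(2) unfolding refines_def by auto
  then show "\<exists>V\<in>v. \<Union>{V \<in> w. V \<inter> W \<noteq> {}} \<subseteq> V"
    using U(2) by (intro bexI[of _ V] subset_trans[OF U(2)])
qed

lemma star_refinesD:
  assumes "star_refines w u" "W \<in> w"
  obtains U where "U \<in> u" "\<And>V. V \<in> w \<Longrightarrow> V \<inter> W \<noteq> {} \<Longrightarrow> V \<subseteq> U"
proof -
  obtain U where "U \<in> u" "\<Union>{V \<in> w. V \<inter> W \<noteq> {}} \<subseteq> U"
    using assms unfolding star_refines_def by auto
  then show thesis by (intro that[of U]) auto
qed

lemma star_sym: "x \<in> star y u \<longleftrightarrow> y \<in> star x u"
  unfolding star_def by blast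

lemma star_mono: "refines v u \<Longrightarrow> star x v \<subseteq> star x u"
  unfolding star_def refines_def by fastforce

text \<open>The cover is shrunk to finitely many closed \<open>K i\<close> inside \<open>U i\<close>
  whose open parts \<open>V i\<close> still cover, and \<open>W x\<close> records on which side of
  each \<open>K i\<close> the point \<open>x\<close> lies. If \<open>W x\<close> contains a point
  \<open>y\<close> of \<open>V i\<close>, then \<open>x\<close> cannot lie off \<open>K i\<close>,
  as \<open>W x\<close> would avoid \<open>K i\<close>; hence \<open>W x\<close> is inside
  \<open>U i\<close>, and so is the whole star of \<open>y\<close>.\<close>

lemma exists_open_point_star_refinement:
  assumes X: "compact_space X" "Hausdorff_space X" and u: "open_cover X u"
  obtains w where "open_cover X w" "\<And>y. y \<in> topspace X \<Longrightarrow> \<exists>U\<in>u. star y w \<subseteq> U"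
proof -
  have reg: "neighbourhood_base_of (closedin X) X"
    using X compact_Hausdorff_imp_regular_space neighbourhood_base_of_closedin by blast
  have "\<exists>U V K. U \<in> u \<and> openin X V \<and> closedin X K \<and> x \<in> V \<and> V \<subseteq> K \<and> K \<subseteq> U"
    if x: "x \<in> topspace X" for x
  proof -
    obtain U where U: "U \<in> u" "x \<in> U" "openin X U"
      using u x unfolding open_cover_def by blast
    then show ?thesis using reg unfolding neighbourhood_base_of by metis
  qed
  then obtain U V K where UVK: "\<And>x. x \<in> topspace X \<Longrightarrow>
      U x \<in> u \<and> openin X (V x) \<and> closedin X (K x) \<and> x \<in> V x \<and> V x \<subseteq> K x \<and> K x \<subseteq> U x"
    by metis
  have "topspace X \<subseteq> \<Union>(V ` topspace X)" "\<And>A. A \<in> V ` topspace X \<Longrightarrow> openin X A"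
    using UVK by blast+
  then obtain \<F> where "finite \<F>" "\<F> \<subseteq> V ` topspace X" "topspace X \<subseteq> \<Union>\<F>"
    using X(1) compactinD[of X "topspace X" "V ` topspace X"] unfolding compact_space_def by blast
  then obtain I where I: "finite I" "I \<subseteq> topspace X" "topspace X \<subseteq> (\<Union>i\<in>I. V i)"
    by (metis finite_subset_image)
  define W where "W x = (\<Inter>i\<in>I. if x \<in> K i then U i else topspace X - K i) \<inter> topspace X" for x
  have "openin X (W x)" for x
    unfolding W_def
  proof (rule openin_INT)
    fix i assume "i \<in> I"
    then have "i \<in> topspace X" using I by blast
    then have "openin X (U i)" "openin X (topspace X - K i)"
      using UVK u unfolding open_cover_def by blast+
    then show "openin X (if x \<in> K i then U i else topspace X - K i)" by simp
  qed (rule I(1))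
  moreover have "x \<in> W x" if "x \<in> topspace X" for x
  proof -
    have "x \<in> (if x \<in> K i then U i else topspace X - K i)" if "i \<in> I" for i
      using UVK[of i] I(2) that \<open>x \<in> topspace X\<close> by (auto dest: subsetD)
    then show ?thesis unfolding W_def using that by blast
  qed
  moreover have "W x \<subseteq> topspace X" for x unfolding W_def by blast
  ultimately have "open_cover X (W ` topspace X)"
    unfolding open_cover_def by blast
  moreover have "\<exists>U\<in>u. star y (W ` topspace X) \<subseteq> U" if y: "y \<in> topspace X" for y
  proof -
    obtain i where i: "i \<in> I" "y \<in> V i" using I y by blast
    then have yK: "y \<in> K i" "U i \<in> u" using I UVK by blast+
    have "W x \<subseteq> U i" if "y \<in> W x" for x
      using that yK i(1) unfolding W_def by (cases "x \<in> K i") auto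
    then have "star y (W ` topspace X) \<subseteq> U i" unfolding star_def by blast
    then show ?thesis using yK by blast
  qed
  ultimately show thesis by (rule that)
qed

text \<open>Two rounds of point-star refinement suffice: a set meeting \<open>W\<close> in
  \<open>z\<close> lies together with \<open>W\<close> in one member of the intermediate cover,
  hence all such sets lie in the intermediate star of any fixed point of \<open>W\<close>.\<close>

lemma exists_open_star_refinement:
  assumes X: "compact_space X" "Hausdorff_space X" and u: "open_cover X u"
  obtains w where "open_cover X w" "star_refines w u"
proof -
  obtain v where v: "open_cover X v" "\<And>y. y \<in> topspace X \<Longrightarrow> \<exists>U\<in>u. star y v \<subseteq> U"
    using exists_open_point_star_refinement[OF X u] by metis
  obtain w where w: "open_cover X w" "\<And>y. y \<in> topspace X \<Longrightarrow> \<exists>U\<in>v. star y w \<subseteq> U"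
    using exists_open_point_star_refinement[OF X v(1)] by metis
  \<comment> \<open>An empty member offers no point at which to take the star, and over the empty
    space \<open>u\<close> may have no member to contain it.\<close>
  have "open_cover X (w - {{}})" using w(1) unfolding open_cover_def by auto
  moreover have "star_refines (w - {{}}) u"
    unfolding star_refines_def
  proof
    fix W assume W: "W \<in> w - {{}}"
    then obtain x where x: "x \<in> W" by blast
    have sub: "A \<subseteq> topspace X" if "A \<in> w" for A
      using w(1) that unfolding open_cover_def by blast
    then have "x \<in> topspace X" using x W by auto
    from v(2)[OF this] obtain U where U: "U \<in> u" "star x v \<subseteq> U" by auto
    have "A \<subseteq> U" if A: "A \<in> w" "A \<inter> W \<noteq> {}" for A
    proof -
      obtain z where z: "z \<in> A" "z \<in> W" using A by blast
      obtain V where V: "V \<in> v" "star z w \<subseteq> V" using w(2) sub A(1) z(1) by blast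
      have "A \<subseteq> V" "W \<subseteq> V" using V(2) A W z unfolding star_def by blast+
      then have "A \<subseteq> star x v" using x V(1) unfolding star_def by blast
      then show ?thesis using U by blast
    qed
    then show "\<exists>U\<in>u. \<Union> {V' \<in> w - {{}}. V' \<inter> W \<noteq> {}} \<subseteq> U" using U(1) by blast
  qed
  ultimately show thesis by (rule that)
qed

lemma open_cover_uniformity_iff:
  "v \<in> open_cover_uniformity X \<longleftrightarrow> is_cover (topspace X) v \<and> (\<exists>w. open_cover X w \<and> refines w v)"
  unfolding open_cover_uniformity_def covers_generated_by_def by blast

lemma open_cover_in_uniformity: "open_cover X w \<Longrightarrow> w \<in> open_cover_uniformity X"
  unfolding open_cover_uniformity_iff is_cover_def using refines_refl
  by (auto simp: open_cover_def)

lemma exists_common_open_star_refinement: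
  assumes X: "compact_space X" "Hausdorff_space X" and u: "open_cover X u" "open_cover X v"
  obtains w where "open_cover X w" "star_refines w u" "star_refines w v"
proof -
  let ?m = "{A \<inter> B | A B. A \<in> u \<and> B \<in> v}"
  have "open_cover X ?m"
    unfolding open_cover_def
  proof
    show "\<forall>W\<in>?m. openin X W" using u unfolding open_cover_def by (auto intro!: openin_Int)
    have "\<Union>?m = \<Union>u \<inter> \<Union>v" by blast
    then show "\<Union>?m = topspace X" using u unfolding open_cover_def by simp
  qed
  then obtain w where "open_cover X w" "star_refines w ?m"
    using exists_open_star_refinement[OF X] by blast
  moreover have "refines ?m u" "refines ?m v" unfolding refines_def by blast+
  ultimately show thesis using that star_refines_mono by blast
qed

lemma cover_uniformity_open_covers:
  assumes X: "compact_space X" "Hausdorff_space X"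
  shows "cover_uniformity (topspace X) (open_cover_uniformity X)"
  unfolding cover_uniformity_def
proof (intro conjI ballI allI impI)
  have "open_cover X {topspace X}" unfolding open_cover_def by simp
  then show "open_cover_uniformity X \<noteq> {}" using open_cover_in_uniformity by blast
next
  fix u assume "u \<in> open_cover_uniformity X"
  then show "is_cover (topspace X) u" unfolding open_cover_uniformity_iff by blast
next
  fix u v assume "u \<in> open_cover_uniformity X" "is_cover (topspace X) v \<and> refines u v"
  then show "v \<in> open_cover_uniformity X"
    unfolding open_cover_uniformity_iff using refines_trans by blast
next
  fix u v assume uv: "u \<in> open_cover_uniformity X" "v \<in> open_cover_uniformity X"
  then obtain a b where ab: "open_cover X a" "refines a u" "open_cover X b" "refines b v"
    unfolding open_cover_uniformity_iff by blast
  then obtain w where "open_cover X w" "star_refines w a" "star_refines w b"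
    using exists_common_open_star_refinement[OF X ab(1,3)] by blast
  then show "\<exists>w\<in>open_cover_uniformity X. star_refines w u \<and> star_refines w v"
    using star_refines_mono[OF _ ab(2)] star_refines_mono[OF _ ab(4)]
    by (intro bexI[of _ w] conjI open_cover_in_uniformity)
qed

lemma induces_topology_open_covers:
  assumes "t1_space X"
  shows "induces_topology (open_cover_uniformity X) X"
  unfolding induces_topology_def
proof (intro allI iffI conjI ballI)
  fix W assume W: "openin X W"
  show "W \<subseteq> topspace X" using W by (rule openin_subset)
  fix x assume x: "x \<in> W"
  then have "x \<in> topspace X" using W openin_subset by blast
  then have "openin X (topspace X - {x})"
    using closedin_t1_singleton[OF assms] by (simp add: openin_diff)
  \<comment> \<open>Only \<open>W\<close> contains \<open>x\<close> in this cover, so the star of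
    \<open>x\<close> is \<open>W\<close> itself.\<close>
  then have "open_cover X {W, topspace X - {x}}"
    using W x openin_subset[OF W] unfolding open_cover_def by auto
  moreover have "star x {W, topspace X - {x}} \<subseteq> W" unfolding star_def by blast
  ultimately show "\<exists>u\<in>open_cover_uniformity X. star x u \<subseteq> W"
    using open_cover_in_uniformity by blast
next
  fix W assume W: "W \<subseteq> topspace X \<and> (\<forall>x\<in>W. \<exists>u\<in>open_cover_uniformity X. star x u \<subseteq> W)"
  show "openin X W"
  proof (subst openin_subopen, intro ballI)
    fix x assume x: "x \<in> W"
    then obtain u where "u \<in> open_cover_uniformity X" and u: "star x u \<subseteq> W" using W by auto
    then obtain w where w: "open_cover X w" "refines w u"
      unfolding open_cover_uniformity_iff by auto
    then have "x \<in> \<Union>w" using W x unfolding open_cover_def by auto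
    then obtain A where A: "A \<in> w" "x \<in> A" by blast
    moreover have "A \<subseteq> star x w" using A unfolding star_def by blast
    ultimately have "openin X A" "A \<subseteq> star x u"
      using w(1) star_mono[OF w(2)] unfolding open_cover_def by auto
    then show "\<exists>A. openin X A \<and> x \<in> A \<and> A \<subseteq> W" using u A by blast
  qed
qed

section \<open>Uniqueness of the uniformity of a compact space\<close>

lemma cover_uniformity_star_subset:
  assumes "is_cover S u" "x \<in> S" shows "x \<in> star x u"
  using assms unfolding is_cover_def star_def by blast

lemma cover_uniformityD:
  assumes "cover_uniformity S \<U>" "u \<in> \<U>"
  shows "\<Union>u = S" "is_cover S v \<Longrightarrow> refines u v \<Longrightarrow> v \<in> \<U>"
proof -
  note * = assms(1)[unfolded cover_uniformity_def, THEN conjunct2]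
  show "\<Union>u = S"
    using *[THEN conjunct1, rule_format, OF assms(2)] unfolding is_cover_def .
  show "v \<in> \<U>" if "is_cover S v" "refines u v"
    using *[THEN conjunct2, THEN conjunct1, rule_format, OF assms(2) conjI[OF that]] .
qed

lemma cover_uniformity_common_star_refinement:
  assumes "cover_uniformity S \<U>" "u \<in> \<U>" "v \<in> \<U>"
  obtains w where "w \<in> \<U>" "star_refines w u" "star_refines w v"
proof -
  note assms(1)[unfolded cover_uniformity_def, THEN conjunct2, THEN conjunct2, THEN conjunct2]
  from this[rule_format, OF assms(2,3)] that show thesis by auto
qed

text \<open>This is the interior of \<open>A\<close> in the uniform topology. If \<open>w\<close>
  star-refines \<open>v\<close>, then for each point \<open>y\<close> of \<open>star z w\<close> the
  set \<open>star y w\<close> stays in a single member of \<open>v\<close> through \<open>z\<close>,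
  hence in \<open>A\<close>; so the interior contains \<open>star z w\<close>.\<close>

lemma openin_uniform_interior:
  assumes \<U>: "cover_uniformity (topspace X) \<U>" "induces_topology \<U> X"
  shows "openin X {z \<in> topspace X. \<exists>v\<in>\<U>. star z v \<subseteq> A}" (is "openin X ?I")
proof -
  have "\<exists>w\<in>\<U>. star z w \<subseteq> ?I" if z: "z \<in> ?I" for z
  proof -
    obtain v where v: "v \<in> \<U>" "star z v \<subseteq> A" using z by blast
    then obtain w where w: "w \<in> \<U>" "star_refines w v"
      using cover_uniformity_common_star_refinement[OF \<U>(1)] by metis
    have "y \<in> ?I" if y: "y \<in> star z w" for y
    proof -
      obtain W where W: "W \<in> w" "z \<in> W" "y \<in> W" using y unfolding star_def by blast
      then obtain V where V: "V \<in> v" "\<And>B. B \<in> w \<Longrightarrow> B \<inter> W \<noteq> {} \<Longrightarrow> B \<subseteq> V"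
        using star_refinesD[OF w(2)] by metis
      have "W \<subseteq> V" using V(2)[OF W(1)] W by blast
      then have "V \<subseteq> star z v" using V(1) W(2) unfolding star_def by blast
      moreover have "star y w \<subseteq> V" using V(2) W(3) unfolding star_def by blast
      moreover have "y \<in> topspace X"
        using cover_uniformityD(1)[OF \<U>(1) w(1)] W by blast
      ultimately show ?thesis using v(2) w(1) by blast
    qed
    then show ?thesis using w(1) by blast
  qed
  then show ?thesis using \<U>(2) unfolding induces_topology_def by blast
qed

text \<open>Uniform covers are refined by their interiors, which are open and still cover.
  Conversely, an open cover is uniform by a Lebesgue number argument: finitely many local uniform
  covers have a common star refinement. The empty space must be excluded, since there
  \<open>{{{}}}\<close> is a uniformity that lacks the open cover \<open>{}\<close>.\<close>

lemma compact_uniformity_unique: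
  assumes X: "compact_space X" "topspace X \<noteq> {}"
    and \<U>: "cover_uniformity (topspace X) \<U>" "induces_topology \<U> X"
  shows "\<U> = open_cover_uniformity X"
proof
  let ?int = "\<lambda>A. {z \<in> topspace X. \<exists>v\<in>\<U>. star z v \<subseteq> A}"
  have int_sub: "?int A \<subseteq> A" for A
    using cover_uniformity_star_subset[of "topspace X"] cover_uniformityD(1)[OF \<U>(1)]
    unfolding is_cover_def by blast
  have int_open: "openin X (?int A)" for A
    using openin_uniform_interior[OF \<U>] .
  show "\<U> \<subseteq> open_cover_uniformity X"
  proof
    fix u assume u: "u \<in> \<U>"
    then obtain w where w: "w \<in> \<U>" "star_refines w u"
      using cover_uniformity_common_star_refinement[OF \<U>(1)] by metis
    have cov: "\<Union>u = topspace X" "\<Union>w = topspace X"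
      using u w(1) cover_uniformityD(1)[OF \<U>(1)] by auto
    have "x \<in> \<Union>(?int ` u)" if x: "x \<in> topspace X" for x
    proof -
      obtain W where W: "W \<in> w" "x \<in> W" using x cov by blast
      obtain U where U: "U \<in> u" "\<And>B. B \<in> w \<Longrightarrow> B \<inter> W \<noteq> {} \<Longrightarrow> B \<subseteq> U"
        using star_refinesD[OF w(2) W(1)] by metis
      then have "star x w \<subseteq> U" using W(2) unfolding star_def by blast
      then have "x \<in> ?int U" using x w(1) by blast
      then show ?thesis using U(1) by blast
    qed
    then have "\<Union>(?int ` u) = topspace X" by blast
    then have "open_cover X (?int ` u)" using int_open unfolding open_cover_def by blast
    moreover have "refines (?int ` u) u" using int_sub unfolding refines_def by blast
    ultimately show "u \<in> open_cover_uniformity X"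
      unfolding open_cover_uniformity_iff is_cover_def using cov by blast
  qed
  show "open_cover_uniformity X \<subseteq> \<U>"
  proof
    fix v assume "v \<in> open_cover_uniformity X"
    then obtain u where v: "is_cover (topspace X) v" and u: "open_cover X u" "refines u v"
      unfolding open_cover_uniformity_iff by blast
    \<comment> \<open>\<open>a x\<close> measures the room around \<open>x\<close> inside
      \<open>U x\<close>, and \<open>w x\<close> halves it: a member of \<open>w x\<close> that
      meets another member through \<open>x\<close> still lies in
      \<open>star x (a x)\<close>.\<close>
    have "\<exists>U w a. U \<in> u \<and> w \<in> \<U> \<and> a \<in> \<U> \<and> star_refines w a \<and> star x a \<subseteq> U"
      if x: "x \<in> topspace X" for x
    proof -
      obtain U where U: "U \<in> u" "x \<in> U" using x u(1) unfolding open_cover_def by blast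
      then have "openin X U" using u(1) unfolding open_cover_def by blast
      then obtain a where a: "a \<in> \<U>" "star x a \<subseteq> U"
        using \<U>(2) U unfolding induces_topology_def by blast
      then obtain w where "w \<in> \<U>" "star_refines w a"
        using cover_uniformity_common_star_refinement[OF \<U>(1)] by metis
      then show ?thesis using U a by blast
    qed
    then obtain U w a where Uwa: "\<And>x. x \<in> topspace X \<Longrightarrow>
        U x \<in> u \<and> w x \<in> \<U> \<and> a x \<in> \<U> \<and> star_refines (w x) (a x) \<and> star x (a x) \<subseteq> U x"
      by metis
    define N where "N x = ?int (star x (w x))" for x
    have N: "openin X (N x)" "N x \<subseteq> star x (w x)" for x
      unfolding N_def using int_open int_sub by blast+
    have xN: "x \<in> N x" if "x \<in> topspace X" for x
      unfolding N_def using Uwa that by blast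
    have "\<And>A. A \<in> N ` topspace X \<Longrightarrow> openin X A" "topspace X \<subseteq> \<Union>(N ` topspace X)"
      using N xN by blast+
    then obtain \<F> where "finite \<F>" "\<F> \<subseteq> N ` topspace X" "topspace X \<subseteq> \<Union>\<F>"
      using X(1) compactinD[of X "topspace X" "N ` topspace X"] unfolding compact_space_def by blast
    then obtain I where I: "finite I" "I \<subseteq> topspace X" "topspace X \<subseteq> (\<Union>i\<in>I. N i)"
      by (metis finite_subset_image)
    have "\<exists>z\<in>\<U>. \<forall>i\<in>J. star_refines z (w i)" if "finite J" "J \<subseteq> topspace X" for J
      using that
    proof (induction J)
      case empty
      then show ?case using \<U>(1) unfolding cover_uniformity_def by blast
    next
      case (insert j J)
      then obtain z where z: "z \<in> \<U>" "\<forall>i\<in>J. star_refines z (w i)" by blast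
      have "w j \<in> \<U>" using Uwa insert by blast
      then obtain z' where z': "z' \<in> \<U>" "star_refines z' z" "star_refines z' (w j)"
        using cover_uniformity_common_star_refinement[OF \<U>(1) z(1)] by metis
      have "star_refines z' (w i)" if i: "i \<in> J" for i
      proof -
        have "refines z (w i)"
          unfolding refines_def
        proof
          fix Z assume Z: "Z \<in> z"
          then obtain B where B: "B \<in> w i" "\<And>C. C \<in> z \<Longrightarrow> C \<inter> Z \<noteq> {} \<Longrightarrow> C \<subseteq> B"
            using star_refinesD z(2) i by metis
          show "\<exists>B\<in>w i. Z \<subseteq> B" using B(1) B(2)[OF Z] by blast
        qed
        then show ?thesis using z'(2) star_refines_mono by blast
      qed
      then show ?case using z' by blast
    qed
    then obtain z where z: "z \<in> \<U>" "\<forall>i\<in>I. star_refines z (w i)" using I by blast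
    have "refines z u"
      unfolding refines_def
    proof
      fix Z assume Z: "Z \<in> z"
      show "\<exists>A\<in>u. Z \<subseteq> A"
      proof (cases "Z = {}")
        case True
        then show ?thesis using X(2) u(1) unfolding open_cover_def by blast
      next
        case False
        then obtain p where p: "p \<in> Z" by blast
        moreover have "Z \<subseteq> topspace X"
          using cover_uniformityD(1)[OF \<U>(1) z(1)] Z by blast
        ultimately obtain i where i: "i \<in> I" "p \<in> N i" using I by blast
        then have it: "i \<in> topspace X" using I by blast
        obtain B where B: "B \<in> w i" "p \<in> B" "i \<in> B" using N(2)[of i] i unfolding star_def by blast
        obtain C where C: "C \<in> w i" "\<And>D. D \<in> z \<Longrightarrow> D \<inter> Z \<noteq> {} \<Longrightarrow> D \<subseteq> C"
          using star_refinesD z(2) i(1) Z by metis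
        have ZC: "Z \<subseteq> C" using C(2)[OF Z] p by blast
        have "star_refines (w i) (a i)" using Uwa it by blast
        then obtain V where V: "V \<in> a i" "\<And>D. D \<in> w i \<Longrightarrow> D \<inter> B \<noteq> {} \<Longrightarrow> D \<subseteq> V"
          using star_refinesD B(1) by metis
        have "B \<subseteq> V" "C \<subseteq> V" using V(2)[OF B(1)] V(2)[OF C(1)] B ZC p by blast+
        then have "Z \<subseteq> star i (a i)" using V(1) B(3) ZC unfolding star_def by blast
        also have "\<dots> \<subseteq> U i" using Uwa it by blast
        finally show ?thesis using Uwa it by blast
      qed
    qed
    then have "refines z v" using u(2) refines_trans by blast
    then show "v \<in> \<U>" using cover_uniformityD(2)[OF \<U>(1) z(1) v] by simp
  qed
qed

lemma compact_uniformity_eq: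
  assumes "compact_space X" "Hausdorff_space X" "topspace X \<noteq> {}"
  shows "compact_uniformity X = open_cover_uniformity X"
  unfolding compact_uniformity_def
proof (rule the_equality)
  show "cover_uniformity (topspace X) (open_cover_uniformity X) \<and>
      induces_topology (open_cover_uniformity X) X"
    using cover_uniformity_open_covers[OF assms(1,2)] induces_topology_open_covers[of X]
      Hausdorff_imp_t1_space[OF assms(2)]
    by blast
qed (use assms compact_uniformity_unique in blast)

section \<open>Traces of open covers along a map\<close>

lemma refines_trace:
  assumes "refines u v"
  shows "refines ((\<lambda>W. b -` W \<inter> S) ` u) ((\<lambda>W. b -` W \<inter> S) ` v)"
  unfolding refines_def
proof clarify
  fix U assume "U \<in> u"
  then obtain V where "V \<in> v" "U \<subseteq> V" using assms unfolding refines_def by auto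
  then show "\<exists>V\<in>(\<lambda>W. b -` W \<inter> S) ` v. b -` U \<inter> S \<subseteq> V"
    by (intro bexI[of _ "b -` V \<inter> S"]) auto
qed

lemma trace_open_cover_uniformity_iff:
  "v \<in> trace_uniformity S b (open_cover_uniformity X) \<longleftrightarrow>
     is_cover S v \<and> (\<exists>w. open_cover X w \<and> refines ((\<lambda>W. b -` W \<inter> S) ` w) v)"
proof -
  have *: "{b -` W \<inter> S | W. W \<in> w} = (\<lambda>W. b -` W \<inter> S) ` w" for w
    by auto
  have "\<exists>w. open_cover X w \<and> refines ((\<lambda>W. b -` W \<inter> S) ` w) v"
    if "w \<in> open_cover_uniformity X" "refines ((\<lambda>W. b -` W \<inter> S) ` w) v" for w
  proof -
    obtain w' where w': "open_cover X w'" "refines w' w"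
      using \<open>w \<in> _\<close> unfolding open_cover_uniformity_iff by blast
    have "refines ((\<lambda>W. b -` W \<inter> S) ` w') v"
      using refines_trans[OF refines_trace[OF w'(2)] that(2)] .
    then show ?thesis using w'(1) by blast
  qed
  then show ?thesis
    unfolding trace_uniformity_def covers_generated_by_def *
    using open_cover_in_uniformity by blast
qed

text \<open>Makes the maximality in \<open>finest_totally_bounded_in\<close> applicable to
  compactifications. Star refinement passes to traces because traces that meet come from sets that
  meet; finite subcovers come from compactness.\<close>

lemma totally_bounded_trace_uniformity:
  assumes X: "compact_space X" "Hausdorff_space X" and b: "b ` S \<subseteq> topspace X"
  shows "totally_bounded_uniformity S (trace_uniformity S b (open_cover_uniformity X))"
    (is "totally_bounded_uniformity S ?\<U>")
proof -
  let ?t = "\<lambda>W. b -` W \<inter> S"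
  have cov: "is_cover S (?t ` w)" if "open_cover X w" for w
  proof -
    have "\<Union>(?t ` w) = b -` \<Union>w \<inter> S" by auto
    also have "\<dots> = S" using b that unfolding open_cover_def by auto
    finally show ?thesis unfolding is_cover_def .
  qed
  have mem: "?t ` w \<in> ?\<U>" if "open_cover X w" for w
    unfolding trace_open_cover_uniformity_iff using that cov refines_refl by blast
  have "cover_uniformity S ?\<U>"
    unfolding cover_uniformity_def
  proof (intro conjI ballI allI impI)
    have "open_cover X {topspace X}" unfolding open_cover_def by simp
    then show "?\<U> \<noteq> {}" using mem by blast
  next
    fix u assume "u \<in> ?\<U>" then show "is_cover S u"
      unfolding trace_open_cover_uniformity_iff by blast
  next
    fix u v assume "u \<in> ?\<U>" "is_cover S v \<and> refines u v"
    then show "v \<in> ?\<U>" unfolding trace_open_cover_uniformity_iff using refines_trans by blast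
  next
    have tr: "star_refines (?t ` w) u" if w: "star_refines w a" "refines (?t ` a) u" for w a u
      unfolding star_refines_def
    proof
      fix V assume "V \<in> ?t ` w"
      then obtain W where W: "W \<in> w" "V = ?t W" by blast
      obtain A where A: "A \<in> a" "\<And>B. B \<in> w \<Longrightarrow> B \<inter> W \<noteq> {} \<Longrightarrow> B \<subseteq> A"
        using star_refinesD[OF w(1) W(1)] by metis
      obtain U where U: "U \<in> u" "?t A \<subseteq> U" using w(2) A(1) unfolding refines_def by blast
      have "\<Union> {V' \<in> ?t ` w. V' \<inter> V \<noteq> {}} \<subseteq> ?t A" using A(2) W by blast
      then show "\<exists>U\<in>u. \<Union> {V' \<in> ?t ` w. V' \<inter> V \<noteq> {}} \<subseteq> U" using U by blast
    qed
    fix u v assume "u \<in> ?\<U>" "v \<in> ?\<U>"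
    then obtain p q where pq: "open_cover X p" "refines (?t ` p) u" "open_cover X q"
        "refines (?t ` q) v"
      unfolding trace_open_cover_uniformity_iff by blast
    then obtain w where w: "open_cover X w" "star_refines w p" "star_refines w q"
      using exists_common_open_star_refinement[OF X pq(1,3)] by blast
    show "\<exists>w\<in>?\<U>. star_refines w u \<and> star_refines w v"
      using mem[OF w(1)] tr[OF w(2) pq(2)] tr[OF w(3) pq(4)] by blast
  qed
  moreover have "\<exists>v\<subseteq>u. finite v \<and> is_cover S v" if u: "u \<in> ?\<U>" for u
  proof -
    obtain w where w: "open_cover X w" "refines (?t ` w) u" and us: "is_cover S u"
      using u unfolding trace_open_cover_uniformity_iff by blast
    have "\<And>W. W \<in> w \<Longrightarrow> openin X W" "topspace X \<subseteq> \<Union>w"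
      using w(1) unfolding open_cover_def by simp_all
    then obtain \<F> where F: "finite \<F>" "\<F> \<subseteq> w" "topspace X \<subseteq> \<Union>\<F>"
      using compactinD[OF X(1)[unfolded compact_space_def], of w] by metis
    have "\<forall>W\<in>\<F>. \<exists>U\<in>u. ?t W \<subseteq> U" using w(2) F(2) unfolding refines_def by blast
    then obtain h where h: "\<And>W. W \<in> \<F> \<Longrightarrow> h W \<in> u \<and> ?t W \<subseteq> h W" by metis
    have "S \<subseteq> \<Union>(h ` \<F>)"
    proof
      fix s assume s: "s \<in> S"
      then obtain W where "W \<in> \<F>" "b s \<in> W" using b F(3) by blast
      then show "s \<in> \<Union>(h ` \<F>)" using h s by blast
    qed
    moreover have "h ` \<F> \<subseteq> u" using h by blast
    ultimately have "is_cover S (h ` \<F>)" using us unfolding is_cover_def by blast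
    then show ?thesis using \<open>h ` \<F> \<subseteq> u\<close> F(1) by blast
  qed
  ultimately show ?thesis unfolding totally_bounded_uniformity_def by blast
qed

section \<open>Comparing compactifications\<close>

lemma compactificationD:
  assumes "compactification T (X, b)"
  shows "compact_space X" "Hausdorff_space X" "continuous_map T X b" "inj_on b (topspace T)"
    "Abstract_Topology.closure_of X (b ` topspace T) = topspace X"
proof -
  have "homeomorphic_map T (subtopology X (b ` topspace T)) b"
    using assms unfolding compactification_def embedding_map_def by simp
  then show "continuous_map T X b" "inj_on b (topspace T)"
    unfolding homeomorphic_eq_everything_map using continuous_map_in_subtopology by auto
qed (use assms in \<open>simp_all add: compactification_def\<close>)

lemma compactification_dense:
  assumes "compactification T (X, b)" "openin X W" "x \<in> W"
  obtains g where "g \<in> topspace T" "b g \<in> W"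
  using compactificationD(5)[OF assms(1)] assms(2,3)
  unfolding dense_intersects_open by blast

lemma compactification_open_trace:
  assumes "compactification T (X, b)" "openin T N"
  obtains W where "openin X W" "\<And>g. g \<in> topspace T \<Longrightarrow> b g \<in> W \<longleftrightarrow> g \<in> N"
proof -
  have "homeomorphic_map T (subtopology X (b ` topspace T)) b"
    using assms unfolding compactification_def embedding_map_def by simp
  then have "openin (subtopology X (b ` topspace T)) (b ` N)"
    using homeomorphic_imp_open_map assms(2) unfolding open_map_def by metis
  then obtain W where W: "openin X W" "b ` N = W \<inter> b ` topspace T"
    unfolding openin_subtopology by auto
  have "b g \<in> W \<longleftrightarrow> g \<in> N" if g: "g \<in> topspace T" for g
  proof -
    have "b g \<in> W \<longleftrightarrow> b g \<in> b ` N" using W(2) g by simp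
    also have "\<dots> \<longleftrightarrow> g \<in> N"
      using inj_on_image_mem_iff[OF compactificationD(4)[OF assms(1)] g openin_subset[OF assms(2)]] .
    finally show ?thesis .
  qed
  then show thesis using that W(1) by simp
qed

lemma compactificationI:
  assumes "compact_space X" "Hausdorff_space X" and b: "continuous_map T X b"
    and inj: "inj_on b (topspace T)"
    and emb: "\<And>N g. openin T N \<Longrightarrow> g \<in> N \<Longrightarrow>
      \<exists>W. openin X W \<and> b g \<in> W \<and> (\<forall>h\<in>topspace T. b h \<in> W \<longrightarrow> h \<in> N)"
    and "Abstract_Topology.closure_of X (b ` topspace T) = topspace X"
  shows "compactification T (X, b)"
proof -
  let ?S = "subtopology X (b ` topspace T)"
  have top: "topspace ?S = b ` topspace T"
    using continuous_map_image_subset_topspace[OF b] by auto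
  have "homeomorphic_map T ?S b"
  proof (rule bijective_open_imp_homeomorphic_map)
    show "continuous_map T ?S b" using b by (simp add: continuous_map_in_subtopology)
    show "open_map T ?S b"
      unfolding open_map_def
    proof (intro allI impI)
      fix N assume N: "openin T N"
      show "openin ?S (b ` N)"
      proof (subst openin_subopen, clarify)
        fix g assume g: "g \<in> N"
        obtain W where W: "openin X W" "b g \<in> W" "\<forall>h\<in>topspace T. b h \<in> W \<longrightarrow> h \<in> N"
          using emb[OF N g] by auto
        have "openin ?S (W \<inter> b ` topspace T)" using W(1) unfolding openin_subtopology by auto
        moreover have "b g \<in> W \<inter> b ` topspace T" using W(2) g openin_subset[OF N] by auto
        moreover have "W \<inter> b ` topspace T \<subseteq> b ` N" using W(3) by auto
        ultimately show "\<exists>V. openin ?S V \<and> b g \<in> V \<and> V \<subseteq> b ` N" by blast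
      qed
    qed
  qed (use top inj in auto)
  then show ?thesis using assms unfolding compactification_def embedding_map_def by simp
qed

text \<open>
  The closure of the set of pairs \<open>(d g, c g)\<close> is the graph of the comparison map; the separation
  hypothesis says that it is single-valued.
\<close>

lemma comp_leI:
  assumes Y: "compactification T (Y, c)" and Z: "compactification T (Z, d)"
    and sep: "\<And>z y y'. z \<in> topspace Z \<Longrightarrow> y \<in> topspace Y \<Longrightarrow> y' \<in> topspace Y \<Longrightarrow> y \<noteq> y' \<Longrightarrow>
      \<exists>W U U'. openin Z W \<and> openin Y U \<and> openin Y U' \<and> z \<in> W \<and> y \<in> U \<and> y' \<in> U' \<and>
        (\<forall>g\<in>topspace T. \<forall>h\<in>topspace T. d g \<in> W \<and> d h \<in> W \<longrightarrow> \<not> (c g \<in> U \<and> c h \<in> U'))"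
  shows "comp_le T (Y, c) (Z, d)"
proof -
  note Y' = compactificationD[OF Y] and Z' = compactificationD[OF Z]
  let ?P = "prod_topology Z Y"
  let ?A = "(\<lambda>g. (d g, c g)) ` topspace T"
  define \<Phi> where "\<Phi> = Abstract_Topology.closure_of ?P ?A"
  have P: "compact_space ?P" using Y' Z' by (simp add: compact_space_prod_topology)
  have cl: "closedin ?P \<Phi>" unfolding \<Phi>_def by simp
  have fst_closed: "closedin Z (fst ` B)" if "closedin ?P B" for B
    using continuous_imp_closed_map[OF continuous_map_fst P Z'(2)] that
    by (simp add: closed_map_def)
  have A_sub: "?A \<subseteq> topspace ?P"
    using continuous_map_image_subset_topspace[OF Y'(3)]
      continuous_map_image_subset_topspace[OF Z'(3)] by auto
  then have A_in: "(d g, c g) \<in> \<Phi>" if "g \<in> topspace T" for g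
    using that closure_of_subset[of ?A ?P] unfolding \<Phi>_def by auto
  have "d ` topspace T \<subseteq> fst ` \<Phi>"
    using A_in by force
  \<comment> \<open>The projection of a closed subset of the compact product is closed, and this one
    contains the dense image of \<open>d\<close>.\<close>
  then have tot: "topspace Z \<subseteq> fst ` \<Phi>"
    using closure_of_minimal[OF _ fst_closed[OF cl]] Z'(5) by metis
  have \<Phi>_sub: "z \<in> topspace Z" "y \<in> topspace Y" if "(z, y) \<in> \<Phi>" for z y
    using closedin_subset[OF cl] that by auto
  have single_valued: "y = y'" if yy: "(z, y) \<in> \<Phi>" "(z, y') \<in> \<Phi>" for z y y'
  proof (rule ccontr)
    assume "y \<noteq> y'"
    from sep[OF \<Phi>_sub(1)[OF yy(1)] \<Phi>_sub(2)[OF yy(1)] \<Phi>_sub(2)[OF yy(2)] this]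
    obtain W U U' where W: "openin Z W" "openin Y U" "openin Y U'" "z \<in> W" "y \<in> U" "y' \<in> U'"
      "\<And>g h. g \<in> topspace T \<Longrightarrow> h \<in> topspace T \<Longrightarrow> d g \<in> W \<Longrightarrow> d h \<in> W \<Longrightarrow> c g \<in> U \<Longrightarrow> c h \<notin> U'"
      by metis
    have hit: "\<exists>g\<in>topspace T. d g \<in> W \<and> c g \<in> B" if "openin Y B" "p \<in> B" "(z, p) \<in> \<Phi>" for B p
    proof -
      have "openin ?P (W \<times> B)" using W(1) that(1) by (simp add: openin_prod_Times_iff)
      moreover have "(z, p) \<in> W \<times> B" using W(4) that(2) by simp
      ultimately show ?thesis using that(3) unfolding \<Phi>_def in_closure_of by auto
    qed
    show False using hit[OF W(2,5) yy(1)] hit[OF W(3,6) yy(2)] W(7) by metis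
  qed
  define f where "f z = (THE y. (z, y) \<in> \<Phi>)" for z
  have f_eq: "f z = y" if "(z, y) \<in> \<Phi>" for z y
    unfolding f_def using that single_valued by (intro the_equality) auto
  have f_in: "(z, f z) \<in> \<Phi>" if "z \<in> topspace Z" for z
  proof -
    have "z \<in> fst ` \<Phi>" using tot that by blast
    then obtain y where "(z, y) \<in> \<Phi>" by (elim imageE) (metis prod.collapse)
    then show ?thesis using f_eq by simp
  qed
  have "continuous_map Z Y f"
    unfolding continuous_map_closedin
  proof (intro conjI allI impI)
    show "f \<in> topspace Z \<rightarrow> topspace Y" using f_in \<Phi>_sub(2) by auto
    fix B assume B: "closedin Y B"
    \<comment> \<open>The preimage of \<open>B\<close> is the projection of the part of the relation
      whose second coordinate lies in \<open>B\<close>, so closedness follows without any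
      neighbourhoods.\<close>
    have "closedin ?P (\<Phi> \<inter> topspace Z \<times> B)"
      using B cl by (intro closedin_Int) (auto simp: closedin_prod_Times_iff)
    moreover have "{z \<in> topspace Z. f z \<in> B} = fst ` (\<Phi> \<inter> topspace Z \<times> B)"
    proof (intro subset_antisym subsetI)
      fix z assume z: "z \<in> {z \<in> topspace Z. f z \<in> B}"
      then have "(z, f z) \<in> \<Phi> \<inter> topspace Z \<times> B" using f_in by simp
      then show "z \<in> fst ` (\<Phi> \<inter> topspace Z \<times> B)" by force
    qed (use f_eq in auto)
    ultimately show "closedin Z {z \<in> topspace Z. f z \<in> B}" using fst_closed by simp
  qed
  moreover have "c g = f (d g)" if "g \<in> topspace T" for g
    using f_eq[OF A_in[OF that]] by simp
  ultimately show ?thesis unfolding comp_le_def by auto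
qed

section \<open>Comparison through trace uniformities\<close>

lemma subspace_uniformity_iff:
  assumes C: "compactification T (X, b)" and T: "topspace T = carrier G" "carrier G \<noteq> {}"
  shows "v \<in> subspace_uniformity G (X, b) \<longleftrightarrow> is_cover (carrier G) v \<and>
     (\<exists>w. open_cover X w \<and> refines ((\<lambda>W. b -` W \<inter> carrier G) ` w) v)"
proof -
  note C' = compactificationD[OF C]
  have "topspace X \<noteq> {}"
    using continuous_map_image_subset_topspace[OF C'(3)] T by auto
  then show ?thesis
    unfolding subspace_uniformity_def
    by (simp add: compact_uniformity_eq[OF C'(1,2)] trace_open_cover_uniformity_iff)
qed

lemma totally_bounded_subspace_uniformity:
  assumes C: "compactification T (X, b)" and T: "topspace T = carrier G" "carrier G \<noteq> {}"
  shows "totally_bounded_uniformity (carrier G) (subspace_uniformity G (X, b))"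
proof -
  note C' = compactificationD[OF C]
  have b: "b ` carrier G \<subseteq> topspace X"
    using continuous_map_image_subset_topspace[OF C'(3)] T by simp
  then have "topspace X \<noteq> {}" using T by auto
  then show ?thesis
    unfolding subspace_uniformity_def
    using totally_bounded_trace_uniformity[OF C'(1,2) b]
    by (simp add: compact_uniformity_eq[OF C'(1,2)])
qed

lemma trace_cover_in_subspace_uniformity:
  assumes C: "compactification T (X, b)" and T: "topspace T = carrier G" "carrier G \<noteq> {}"
    and w: "open_cover X w"
  shows "(\<lambda>W. b -` W \<inter> carrier G) ` w \<in> subspace_uniformity G (X, b)" (is "?tw \<in> _")
proof -
  have "\<Union>?tw = b -` \<Union>w \<inter> carrier G" by auto
  also have "\<dots> = carrier G"
    using w continuous_map_image_subset_topspace[OF compactificationD(3)[OF C]] T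
    unfolding open_cover_def by auto
  finally have "is_cover (carrier G) ?tw" unfolding is_cover_def .
  then show ?thesis
    unfolding subspace_uniformity_iff[OF C T] using w refines_refl by auto
qed

text \<open>Recasts the Hausdorff property as a uniform cover none of whose members approaches both
  points. It consists of a neighbourhood of \<open>y\<close> disjoint from one of \<open>y'\<close>,
  and the complement of a smaller closed neighbourhood of \<open>y\<close>.\<close>

lemma compact_separating_open_cover:
  assumes Y: "compact_space Y" "Hausdorff_space Y"
    and y: "y \<in> topspace Y" "y' \<in> topspace Y" "y \<noteq> y'"
  obtains w U U' where "open_cover Y w" "openin Y U" "openin Y U'" "y \<in> U" "y' \<in> U'"
    "\<And>A. A \<in> w \<Longrightarrow> A \<inter> U = {} \<or> A \<inter> U' = {}"
proof -
  obtain U V where UV: "openin Y U" "openin Y V" "y \<in> U" "y' \<in> V" "disjnt U V"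
    using Y(2) y unfolding Hausdorff_space_def by metis
  have "neighbourhood_base_of (closedin Y) Y"
    using compact_Hausdorff_imp_regular_space[OF Y] neighbourhood_base_of_closedin by auto
  then obtain U1 K where K: "openin Y U1" "closedin Y K" "y \<in> U1" "U1 \<subseteq> K" "K \<subseteq> U"
    using UV unfolding neighbourhood_base_of by metis
  have "open_cover Y {U, topspace Y - K}"
    using K UV(1) openin_subset[OF UV(1)] unfolding open_cover_def by auto
  moreover have "A \<inter> U1 = {} \<or> A \<inter> V = {}" if "A \<in> {U, topspace Y - K}" for A
    using that K UV(5) by (auto simp: disjnt_def)
  ultimately show thesis using that K(1,3) UV(2,4) by metis
qed

text \<open>A cover of \<open>Y\<close> separating two points has a trace that is also uniform for
  \<open>Z\<close>. Elements of \<open>G\<close> whose images lie in one small open set around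
  \<open>z\<close> are thus sent by \<open>c\<close> into a single member of the separating
  cover.\<close>

lemma comp_leI_uniformity:
  assumes Y: "compactification T (Y, c)" and Z: "compactification T (Z, d)"
    and T: "topspace T = carrier G" "carrier G \<noteq> {}"
    and sub: "subspace_uniformity G (Y, c) \<subseteq> subspace_uniformity G (Z, d)"
  shows "comp_le T (Y, c) (Z, d)"
proof (rule comp_leI[OF Y Z])
  note Y' = compactificationD[OF Y]
  fix z y y' assume z: "z \<in> topspace Z" and y: "y \<in> topspace Y" "y' \<in> topspace Y" "y \<noteq> y'"
  obtain w U U' where w: "open_cover Y w" "openin Y U" "openin Y U'" "y \<in> U" "y' \<in> U'"
    "\<And>A. A \<in> w \<Longrightarrow> A \<inter> U = {} \<or> A \<inter> U' = {}"
    using compact_separating_open_cover[OF Y'(1,2) y] by metis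
  let ?tw = "(\<lambda>W. c -` W \<inter> carrier G) ` w"
  have "?tw \<in> subspace_uniformity G (Y, c)"
    using trace_cover_in_subspace_uniformity[OF Y T w(1)] .
  then have "?tw \<in> subspace_uniformity G (Z, d)" using sub by auto
  then obtain w' where w': "open_cover Z w'" "refines ((\<lambda>W. d -` W \<inter> carrier G) ` w') ?tw"
    unfolding subspace_uniformity_iff[OF Z T] by auto
  have "z \<in> \<Union>w'" using w'(1) z unfolding open_cover_def by auto
  then obtain W where W: "W \<in> w'" "z \<in> W" by auto
  then obtain A where A: "A \<in> w" "d -` W \<inter> carrier G \<subseteq> c -` A \<inter> carrier G"
    using w'(2) unfolding refines_def by auto
  have "openin Z W" using w'(1) W(1) unfolding open_cover_def by auto
  moreover have "\<not> (c g \<in> U \<and> c h \<in> U')"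
    if "g \<in> topspace T" "h \<in> topspace T" "d g \<in> W" "d h \<in> W" for g h
  proof -
    have "c g \<in> A" "c h \<in> A" using A(2) that T(1) by auto
    then show ?thesis using w(6)[OF A(1)] by auto
  qed
  ultimately show "\<exists>W U U'. openin Z W \<and> openin Y U \<and> openin Y U' \<and> z \<in> W \<and> y \<in> U \<and> y' \<in> U' \<and>
        (\<forall>g\<in>topspace T. \<forall>h\<in>topspace T. d g \<in> W \<and> d h \<in> W \<longrightarrow> \<not> (c g \<in> U \<and> c h \<in> U'))"
    using w(2-5) W(2)
    by (intro exI[of _ W] exI[of _ U] exI[of _ U'] conjI ballI impI) simp_all
qed

section \<open>The graph compactification\<close>

text \<open>An arbitrary extension \<open>a\<close> of the left action is a parameter, so that the
  choice made in \<open>extended_action\<close> enters only as one instance at the end.\<close>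

locale G_compactified = topological_group G T
  for G :: "('g, 'm) monoid_scheme" (structure) and T :: "'g topology" +
  fixes X :: "'b topology" and b a
  assumes compactification: "compactification T (X, b)"
    and action_extension: "action_extension G T (left_act G) (X, b) a"
begin

lemmas
  compact = compactificationD(1)[OF compactification] and
  Hausdorff = compactificationD(2)[OF compactification] and
  continuous_b = compactificationD(3)[OF compactification] and
  inj_b = compactificationD(4)[OF compactification, unfolded topspace_eq]

lemma
  shows continuous_action: "continuous_map (prod_topology T X) X (\<lambda>(g, x). a g x)"
    and action_one: "x \<in> topspace X \<Longrightarrow> a \<one> x = x"
    and action_mult: "g \<in> carrier G \<Longrightarrow> h \<in> carrier G \<Longrightarrow> x \<in> topspace X \<Longrightarrow>
      a (g \<otimes> h) x = a g (a h x)"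
    and action_b: "g \<in> carrier G \<Longrightarrow> h \<in> carrier G \<Longrightarrow> a g (b h) = b (g \<otimes> h)"
  using action_extension
  unfolding action_extension_def continuous_action_def left_act_def by simp_all

lemma b_in [simp]: "g \<in> carrier G \<Longrightarrow> b g \<in> topspace X"
  using continuous_map_image_subset_topspace[OF continuous_b] topspace_eq by auto

lemma action_in: "g \<in> carrier G \<Longrightarrow> x \<in> topspace X \<Longrightarrow> a g x \<in> topspace X"
  using continuous_map_image_subset_topspace[OF continuous_action] topspace_eq by force

lemma continuous_action_slice:
  assumes "g \<in> carrier G" shows "continuous_map X X (a g)"
proof -
  have "continuous_map X (prod_topology T X) (\<lambda>x. (g, x))"
    using assms by (simp add: continuous_map_paired topspace_eq)
  from continuous_map_compose[OF this continuous_action] show ?thesis by (simp add: o_def)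
qed

lemma dense:
  assumes "openin X W" "x \<in> W"
  obtains g where "g \<in> carrier G" "b g \<in> W"
  using compactification_dense[OF compactification assms] topspace_eq by metis

section \<open>Graphs of translations and their closure\<close>

definition graph :: "'g \<Rightarrow> ('b \<times> 'b) set" where
  "graph g = {(x, a g x) | x. x \<in> topspace X}"

abbreviation XX :: "('b \<times> 'b) topology" where
  "XX \<equiv> prod_topology X X"

abbreviation H :: "('b \<times> 'b) set topology" where
  "H \<equiv> vietoris XX"

definition K :: "('b \<times> 'b) set set" where
  "K = Abstract_Topology.closure_of H (graph ` carrier G)"

text \<open>On a relation this is composition with the translation by \<open>h\<close> after it,
  which on graphs amounts to left multiplication.\<close>

definition shift :: "'g \<Rightarrow> 'b \<times> 'b \<Rightarrow> 'b \<times> 'b" where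
  "shift h p = (fst p, a h (snd p))"

lemma compact_XX: "compact_space XX" and Hausdorff_XX: "Hausdorff_space XX"
  using compact Hausdorff
  by (simp_all add: compact_space_prod_topology Hausdorff_space_prod_topology)

lemma compact_H: "compact_space H" and Hausdorff_H: "Hausdorff_space H"
  using compact_XX Hausdorff_XX compact_space_vietoris Hausdorff_space_vietoris
    compact_Hausdorff_imp_regular_space by auto

lemma closedin_K: "closedin H K"
  unfolding K_def by simp

lemma K_closedin: "F \<in> K \<Longrightarrow> closedin XX F"
  using closedin_subset[OF closedin_K] unfolding topspace_vietoris by auto

lemma topspace_K: "topspace (subtopology H K) = K"
  using closedin_subset[OF closedin_K] by auto

lemma continuous_graph: "continuous_map T H graph"
proof -
  have "continuous_map (prod_topology T X) XX (\<lambda>(g, x). (x, a g x))"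
    using continuous_action continuous_map_snd[of T X]
    by (simp add: continuous_map_pairwise o_def case_prod_unfold)
  from continuous_map_vietoris_image[OF compact Hausdorff_XX this]
  have c: "continuous_map (prod_topology T (vietoris X)) H (\<lambda>(g, F). (\<lambda>x. (x, a g x)) ` F)" .
  have "continuous_map T (prod_topology T (vietoris X)) (\<lambda>g. (g, topspace X))"
    by (simp add: continuous_map_paired topspace_vietoris)
  from continuous_map_compose[OF this c]
  have "continuous_map T H (\<lambda>g. (\<lambda>x. (x, a g x)) ` topspace X)" by (simp add: o_def)
  moreover have "(\<lambda>g. (\<lambda>x. (x, a g x)) ` topspace X) = graph"
    unfolding graph_def by (auto simp: fun_eq_iff)
  ultimately show ?thesis by simp
qed

lemma graph_in_K: "g \<in> carrier G \<Longrightarrow> graph g \<in> K"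
  using closure_of_subset[of "graph ` carrier G" H]
    continuous_map_image_subset_topspace[OF continuous_graph]
  unfolding K_def topspace_eq by auto

text \<open>The fibre over \<open>b \<one>\<close> recovers the group element from its graph;
  injectivity and the embedding property both rest on it.\<close>

lemma graph_base: "g \<in> carrier G \<Longrightarrow> (b \<one>, y) \<in> graph g \<longleftrightarrow> y = b g"
  unfolding graph_def using action_b[of g \<one>] b_in[of \<one>] by auto

lemma graph_b_iff: "g \<in> carrier G \<Longrightarrow> h \<in> carrier G \<Longrightarrow> (b h, y) \<in> graph g \<longleftrightarrow> y = b (g \<otimes> h)"
  unfolding graph_def using action_b[of g h] b_in[of h] by auto

text \<open>The points of \<open>U\<close> that \<open>g\<close> moves into \<open>V\<close> form an
  open set, so density of \<open>b\<close> provides one in the group. This is why statements about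
  whole graphs can be tested on elements of \<open>G\<close>.\<close>

lemma graph_hits_open:
  assumes g: "g \<in> carrier G" and UV: "openin X U" "openin X V" and hit: "graph g \<inter> U \<times> V \<noteq> {}"
  obtains k where "k \<in> carrier G" "b k \<in> U" "b (g \<otimes> k) \<in> V"
proof -
  obtain x where x: "x \<in> topspace X" "x \<in> U" "a g x \<in> V" using hit unfolding graph_def by auto
  have "openin X {x \<in> topspace X. a g x \<in> V}"
    using continuous_action_slice[OF g] UV(2) by (rule openin_continuous_map_preimage)
  then have "openin X (U \<inter> {x \<in> topspace X. a g x \<in> V})" using UV(1) by (rule openin_Int[rotated])
  moreover have "x \<in> U \<inter> {x \<in> topspace X. a g x \<in> V}" using x by simp
  ultimately obtain k where "k \<in> carrier G" "b k \<in> U \<inter> {x \<in> topspace X. a g x \<in> V}"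
    by (rule dense)
  then show thesis using that action_b[OF g] by auto
qed

text \<open>Both sets have to be hit by the same graph, because two points in one fibre of
  \<open>F\<close> are going to be compared.\<close>

lemma K_hits_open:
  assumes "F \<in> K" and "openin XX W" "F \<inter> W \<noteq> {}"
    and "openin XX W'" "F \<inter> W' \<noteq> {}"
  obtains g where "g \<in> carrier G" "graph g \<inter> W \<noteq> {}" "graph g \<inter> W' \<noteq> {}"
proof -
  let ?A = "{F. closedin XX F \<and> F \<inter> W \<noteq> {}} \<inter> {F. closedin XX F \<and> F \<inter> W' \<noteq> {}}"
  have "openin H ?A" using assms(2,4) by (intro openin_Int openin_vietoris_hit)
  moreover have "F \<in> ?A" using assms K_closedin by simp
  ultimately have "\<exists>F'. F' \<in> graph ` carrier G \<and> F' \<in> ?A"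
    using assms(1)[unfolded K_def in_closure_of, THEN conjunct2, rule_format, of ?A] by simp
  then obtain F' where "F' \<in> graph ` carrier G" "F' \<in> ?A" by (elim exE conjE)
  then show thesis using that by auto
qed

lemma compactification_graph: "compactification T (subtopology H K, graph)"
proof (rule compactificationI)
  show "compact_space (subtopology H K)"
    using closedin_compact_space[OF compact_H closedin_K] by (simp add: compact_space_subtopology)
  show "Hausdorff_space (subtopology H K)"
    using Hausdorff_H by (rule Hausdorff_space_subtopology)
  show "continuous_map T (subtopology H K) graph"
    using continuous_graph graph_in_K by (auto simp: continuous_map_in_subtopology topspace_eq)
  show "inj_on graph (topspace T)"
  proof (rule inj_onI)
    fix g h assume gh: "g \<in> topspace T" "h \<in> topspace T" "graph g = graph h"
    then have "(b \<one>, b g) \<in> graph h" using graph_base[of g] topspace_eq by auto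
    then have "b g = b h" using graph_base[of h] gh topspace_eq by simp
    then show "g = h" using gh inj_b topspace_eq by (auto dest: inj_onD)
  qed
  show "Abstract_Topology.closure_of (subtopology H K) (graph ` topspace T) = topspace (subtopology H K)"
  proof -
    have "graph ` carrier G \<subseteq> K" using graph_in_K by auto
    then have "Abstract_Topology.closure_of (subtopology H K) (graph ` topspace T) = K \<inter> K"
      unfolding closure_of_subtopology topspace_eq K_def by (simp add: Int_absorb1)
    then show ?thesis unfolding topspace_K by simp
  qed
next
  fix N g assume N: "openin T N" "g \<in> N"
  then have g: "g \<in> carrier G" using openin_subset topspace_eq by auto
  obtain W where W: "openin X W" "\<And>h. h \<in> topspace T \<Longrightarrow> b h \<in> W \<longleftrightarrow> h \<in> N"
    using compactification_open_trace[OF compactification N(1)] by metis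
  \<comment> \<open>Away from \<open>b \<one>\<close> this open set imposes no condition, so a graph
    lies inside it exactly when its value at \<open>b \<one>\<close> is in \<open>W\<close>.\<close>
  define O1 where "O1 = (topspace X - {b \<one>}) \<times> topspace X \<union> topspace X \<times> W"
  have "closedin X {b \<one>}"
    using closedin_t1_singleton[OF Hausdorff_imp_t1_space[OF Hausdorff]] by simp
  then have O1: "openin XX O1"
    unfolding O1_def using W(1)
    by (intro openin_Un) (auto simp: openin_prod_Times_iff)
  have graph_O1: "graph h \<subseteq> O1 \<longleftrightarrow> h \<in> N" if h: "h \<in> carrier G" for h
  proof
    assume "graph h \<subseteq> O1"
    then have "(b \<one>, b h) \<in> O1" using graph_base[OF h] by auto
    then have "b h \<in> W" unfolding O1_def by auto
    then show "h \<in> N" using W(2) h topspace_eq by simp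
  next
    assume "h \<in> N"
    then have bh: "b h \<in> W" using W(2) h topspace_eq by simp
    show "graph h \<subseteq> O1"
    proof
      fix p assume p: "p \<in> graph h"
      then obtain x where x: "p = (x, a h x)" "x \<in> topspace X" unfolding graph_def by auto
      show "p \<in> O1"
      proof (cases "x = b \<one>")
        case True
        then have "a h x = b h" using p x graph_base[OF h] by simp
        then show ?thesis using bh x unfolding O1_def by simp
      next
        case False
        then show ?thesis using x action_in[OF h] unfolding O1_def by simp
      qed
    qed
  qed
  let ?W = "{F. closedin XX F \<and> F \<subseteq> O1} \<inter> K"
  have "openin (subtopology H K) ?W"
    using openin_vietoris_subset[OF O1] unfolding openin_subtopology by auto
  moreover have "graph g \<in> ?W" using graph_O1[OF g] N(2) graph_in_K[OF g] K_closedin by simp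
  moreover have "\<forall>h\<in>topspace T. graph h \<in> ?W \<longrightarrow> h \<in> N" using graph_O1 topspace_eq by simp
  ultimately show "\<exists>W. openin (subtopology H K) W \<and> graph g \<in> W \<and>
      (\<forall>h\<in>topspace T. graph h \<in> W \<longrightarrow> h \<in> N)" by (intro exI[of _ ?W] conjI)
qed

section \<open>Left action and inversion on the closure of the graphs\<close>

lemma continuous_shift: "continuous_map (prod_topology T H) H (\<lambda>(h, F). shift h ` F)"
proof (rule continuous_map_vietoris_image[OF compact_XX Hausdorff_XX])
  have "continuous_map (prod_topology T XX) (prod_topology T X) (\<lambda>(h, p). (h, snd p))"
    by (auto simp: continuous_map_pairwise o_def case_prod_unfold
        intro: continuous_map_compose[OF continuous_map_snd, unfolded o_def] continuous_map_fst continuous_map_snd)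
  from continuous_map_compose[OF this continuous_action]
  have "continuous_map (prod_topology T XX) X (\<lambda>(h, p). a h (snd p))"
    by (simp add: o_def case_prod_unfold)
  moreover have "continuous_map (prod_topology T XX) X (\<lambda>(h, p). fst p)"
    using continuous_map_compose[OF continuous_map_snd[of T XX] continuous_map_fst]
    by (simp add: o_def case_prod_unfold)
  ultimately show "continuous_map (prod_topology T XX) XX (\<lambda>(h, p). shift h p)"
    unfolding shift_def by (simp add: continuous_map_pairwise o_def case_prod_unfold)
qed

lemma continuous_shift_slice:
  assumes "h \<in> carrier G" shows "continuous_map H H ((`) (shift h))"
proof -
  have "continuous_map H (prod_topology T H) (\<lambda>F. (h, F))"
    using assms by (simp add: continuous_map_paired topspace_eq)
  from continuous_map_compose[OF this continuous_shift] show ?thesis by (simp add: o_def)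
qed

lemma shift_graph:
  assumes "h \<in> carrier G" "g \<in> carrier G"
  shows "shift h ` graph g = graph (h \<otimes> g)"
proof -
  have "shift h ` graph g = (\<lambda>x. (x, a h (a g x))) ` topspace X"
    unfolding graph_def shift_def by force
  also have "\<dots> = graph (h \<otimes> g)"
    unfolding graph_def using action_mult[OF assms] by force
  finally show ?thesis .
qed

lemma converse_graph:
  assumes "g \<in> carrier G"
  shows "prod.swap ` graph g = graph (inv g)"
proof -
  have 1: "a (inv g) (a g x) = x" "a g (a (inv g) x) = x" if "x \<in> topspace X" for x
    using action_mult[of "inv g" g x] action_mult[of g "inv g" x] action_one[OF that] assms that
    by simp_all
  have "prod.swap ` graph g = (\<lambda>x. (a g x, x)) ` topspace X"
    unfolding graph_def by force
  also have "\<dots> = graph (inv g)"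
    unfolding graph_def
  proof (intro subset_antisym subsetI; clarify)
    fix x assume x: "x \<in> topspace X"
    show "\<exists>y. (a g x, x) = (y, a (inv g) y) \<and> y \<in> topspace X"
      using x 1 action_in[OF assms x] by auto
    show "(x, a (inv g) x) \<in> (\<lambda>x. (a g x, x)) ` topspace X"
      using 1(2)[OF x] action_in[of "inv g" x] assms x
      by (intro image_eqI[of _ _ "a (inv g) x"]) auto
  qed
  finally show ?thesis .
qed

lemma continuous_swap: "continuous_map H H ((`) prod.swap)"
proof (rule continuous_map_vietoris_image_fixed[OF compact_XX Hausdorff_XX])
  show "continuous_map XX XX prod.swap"
    by (simp add: continuous_map_pairwise o_def continuous_map_fst continuous_map_snd)
qed

lemma image_K:
  assumes "continuous_map H H f" "\<And>g. g \<in> carrier G \<Longrightarrow> f (graph g) \<in> K"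
  shows "f ` K \<subseteq> K"
proof -
  have "f ` K \<subseteq> Abstract_Topology.closure_of H (f ` graph ` carrier G)"
    using continuous_map_image_closure_subset[OF assms(1)] unfolding K_def .
  also have "\<dots> \<subseteq> K"
    using assms(2) by (intro closure_of_minimal closedin_K) auto
  finally show ?thesis .
qed

lemma shift_K: "h \<in> carrier G \<Longrightarrow> F \<in> K \<Longrightarrow> shift h ` F \<in> K"
  using image_K[OF continuous_shift_slice[of h]] shift_graph graph_in_K by auto

lemma swap_K: "F \<in> K \<Longrightarrow> prod.swap ` F \<in> K"
  using image_K[OF continuous_swap] converse_graph graph_in_K by auto

lemma continuous_shift_K:
  "continuous_map (prod_topology T (subtopology H K)) (subtopology H K) (\<lambda>(h, F). shift h ` F)"
proof -
  have "prod_topology T (subtopology H K) = subtopology (prod_topology T H) (topspace T \<times> K)"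
    using prod_topology_subtopology(2)[of T H K] by simp
  then have "continuous_map (prod_topology T (subtopology H K)) H (\<lambda>(h, F). shift h ` F)"
    using continuous_map_from_subtopology[OF continuous_shift] by simp
  then show ?thesis
    using shift_K by (auto simp: continuous_map_in_subtopology topspace_eq)
qed

lemma continuous_swap_K: "continuous_map (subtopology H K) (subtopology H K) ((`) prod.swap)"
  using continuous_map_from_subtopology[OF continuous_swap] swap_K
  by (auto simp: continuous_map_in_subtopology)

lemma K_point: "F \<in> K \<Longrightarrow> p \<in> F \<Longrightarrow> fst p \<in> topspace X \<and> snd p \<in> topspace X"
  using closedin_subset[OF K_closedin[of F]] by auto

lemma G_star_graph: "G_star_compactification G T (subtopology H K, graph)"
proof -
  have "continuous_action G T (subtopology H K) (\<lambda>h F. shift h ` F)"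
    unfolding continuous_action_def topspace_K
  proof (intro conjI ballI)
    show "continuous_map (prod_topology T (subtopology H K)) (subtopology H K)
        (\<lambda>(h, F). shift h ` F)" by (rule continuous_shift_K)
    fix F assume F: "F \<in> K"
    have "shift \<one> p = p" if "p \<in> F" for p
      unfolding shift_def using K_point[OF F that] action_one by simp
    then show "shift \<one> ` F = F" by simp
    fix g h assume gh: "g \<in> carrier G" "h \<in> carrier G"
    have "shift (g \<otimes> h) p = shift g (shift h p)" if "p \<in> F" for p
      unfolding shift_def using K_point[OF F that] action_mult gh by simp
    then show "shift (g \<otimes> h) ` F = shift g ` shift h ` F"
      unfolding image_image by simp
  qed
  then have "action_extension G T (left_act G) (subtopology H K, graph) (\<lambda>h F. shift h ` F)"
    unfolding action_extension_def left_act_def using shift_graph by simp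
  then have "G_compactification G T (subtopology H K, graph)"
    unfolding G_compactification_def using compactification_graph by auto
  moreover have "\<forall>F\<in>topspace (subtopology H K). prod.swap ` prod.swap ` F = F"
    by (simp only: image_image) simp
  ultimately show ?thesis
    unfolding G_star_compactification_def prod.case using continuous_swap_K converse_graph
    by (intro conjI exI[of _ "(`) prod.swap"] ballI) simp_all
qed

text \<open>
  The fibre of a limit of graphs over \<open>b \<one>\<close> is nonempty; the hypothesis \<open>sep\<close> makes \<open>f\<close> constant
  on it, and this constant value is the image of the limit.
\<close>

lemma comp_le_graphI:
  assumes f: "continuous_map X Y f" and fb: "\<And>g. g \<in> carrier G \<Longrightarrow> f (b g) = c g"
    and sep: "\<And>y y'. y \<in> topspace X \<Longrightarrow> y' \<in> topspace X \<Longrightarrow> f y \<noteq> f y' \<Longrightarrow>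
      \<exists>N U U'. openin T N \<and> \<one> \<in> N \<and> openin X U \<and> openin X U' \<and> y \<in> U \<and> y' \<in> U' \<and>
        (\<forall>g\<in>carrier G. \<forall>k\<in>N. \<forall>k'\<in>N. \<not> (b (g \<otimes> k) \<in> U \<and> b (g \<otimes> k') \<in> U'))"
  shows "comp_le T (Y, c) (subtopology H K, graph)"
proof -
  let ?B = "\<lambda>A. {b \<one>} \<times> {x \<in> topspace X. f x \<in> A}"
  have "closedin X {b \<one>}"
    using closedin_t1_singleton[OF Hausdorff_imp_t1_space[OF Hausdorff]] by simp
  then have B: "closedin XX (?B A)" if "closedin Y A" for A
    using closedin_continuous_map_preimage[OF f that] by (simp add: closedin_prod_Times_iff)
  have hit: "closedin H {F \<in> topspace H. F \<inter> ?B A \<noteq> {}}" if "closedin Y A" for A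
    using closedin_vietoris_hit[OF B[OF that]] unfolding topspace_vietoris by simp
  \<comment> \<open>Each graph hits this closed set in \<open>(b \<one>, b g)\<close>, and hitting a
    closed set is preserved in the closure.\<close>
  have ne: "F \<inter> ?B (topspace Y) \<noteq> {}" if F: "F \<in> K" for F
  proof (rule forall_in_closure_of[OF F[unfolded K_def] _ hit])
    fix F assume "F \<in> graph ` carrier G"
    then obtain g where g: "g \<in> carrier G" "F = graph g" by auto
    then have "(b \<one>, b g) \<in> F" using graph_base by simp
    moreover have "(b \<one>, b g) \<in> ?B (topspace Y)"
      using g continuous_map_image_subset_topspace[OF f] b_in by auto
    ultimately show "F \<inter> ?B (topspace Y) \<noteq> {}" by blast
  qed simp
  have unique: "f y = f y'" if F: "F \<in> K" and y: "(b \<one>, y) \<in> F" "(b \<one>, y') \<in> F" for F y y'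
  proof (rule ccontr)
    assume neq: "f y \<noteq> f y'"
    have "y \<in> topspace X" "y' \<in> topspace X" using K_point[OF F] y by auto
    from sep[OF this neq] obtain N U U' where N: "openin T N" "\<one> \<in> N" "openin X U" "openin X U'"
      "y \<in> U" "y' \<in> U'"
      "\<And>g k k'. g \<in> carrier G \<Longrightarrow> k \<in> N \<Longrightarrow> k' \<in> N \<Longrightarrow> b (g \<otimes> k) \<in> U \<Longrightarrow> b (g \<otimes> k') \<notin> U'"
      by metis
    \<comment> \<open>The neighbourhood \<open>N\<close> of the unit becomes a neighbourhood of
      \<open>b \<one>\<close> in \<open>X\<close>. A graph near \<open>F\<close> then passes close
      to \<open>y\<close> and to \<open>y'\<close> over elements \<open>k\<close>, \<open>k'\<close>
      of \<open>N\<close>, not necessarily over the unit.\<close>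
    obtain W where W: "openin X W" "\<And>g. g \<in> topspace T \<Longrightarrow> b g \<in> W \<longleftrightarrow> g \<in> N"
      using compactification_open_trace[OF compactification N(1)] by metis
    have bW: "b \<one> \<in> W" using W(2)[of \<one>] N(2) topspace_eq by simp
    have "openin XX (W \<times> U)" "openin XX (W \<times> U')"
      using W(1) N(3,4) by (simp_all add: openin_prod_Times_iff)
    moreover have "F \<inter> W \<times> U \<noteq> {}" "F \<inter> W \<times> U' \<noteq> {}" using bW y N(5,6) by auto
    ultimately obtain g where g: "g \<in> carrier G" "graph g \<inter> W \<times> U \<noteq> {}" "graph g \<inter> W \<times> U' \<noteq> {}"
      using K_hits_open[OF F] by metis
    obtain k where k: "k \<in> carrier G" "b k \<in> W" "b (g \<otimes> k) \<in> U"
      using graph_hits_open[OF g(1) W(1) N(3) g(2)] by metis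
    obtain k' where k': "k' \<in> carrier G" "b k' \<in> W" "b (g \<otimes> k') \<in> U'"
      using graph_hits_open[OF g(1) W(1) N(4) g(3)] by metis
    have "k \<in> N" "k' \<in> N" using W(2) k(1,2) k'(1,2) topspace_eq by auto
    then show False using N(7)[OF g(1)] k(3) k'(3) by simp
  qed
  define \<phi> where "\<phi> F = f (SOME y. (b \<one>, y) \<in> F)" for F
  have \<phi>: "\<phi> F = f y" if F: "F \<in> K" and y: "(b \<one>, y) \<in> F" for F y
    unfolding \<phi>_def using unique[OF F someI[of "\<lambda>y. (b \<one>, y) \<in> F", OF y] y] .
  \<comment> \<open>For closed \<open>A\<close> this expresses the preimage of \<open>A\<close> by
    hitting a closed set, which is how continuity will follow.\<close>
  have \<phi>_hit: "F \<in> K \<and> \<phi> F \<in> A \<longleftrightarrow> F \<in> K \<and> F \<inter> ?B A \<noteq> {}" for F A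
  proof (intro conj_cong refl iffI)
    assume F: "F \<in> K"
    { assume "\<phi> F \<in> A"
      moreover obtain y where y: "(b \<one>, y) \<in> F" using ne[OF F] by auto
      ultimately have "(b \<one>, y) \<in> ?B A" using \<phi>[OF F y] K_point[OF F y] by simp
      then show "F \<inter> ?B A \<noteq> {}" using y by blast }
    { assume "F \<inter> ?B A \<noteq> {}"
      then obtain y where "(b \<one>, y) \<in> F" "f y \<in> A" by auto
      then show "\<phi> F \<in> A" using \<phi>[OF F] by simp }
  qed
  have "continuous_map (subtopology H K) Y \<phi>"
    unfolding continuous_map_closedin topspace_K
  proof (intro conjI allI impI)
    have "\<phi> F \<in> topspace Y" if "F \<in> K" for F
      using iffD2[OF \<phi>_hit conjI[OF that ne[OF that]]] by simp
    then show "\<phi> \<in> K \<rightarrow> topspace Y" by simp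
    fix A assume A: "closedin Y A"
    have "{F \<in> K. \<phi> F \<in> A} = {F \<in> topspace H. F \<inter> ?B A \<noteq> {}} \<inter> K"
      using \<phi>_hit[of _ A] closedin_subset[OF closedin_K] by auto
    then show "closedin (subtopology H K) {F \<in> K. \<phi> F \<in> A}"
      using hit[OF A] unfolding closedin_subtopology by auto
  qed
  moreover have "c g = \<phi> (graph g)" if g: "g \<in> carrier G" for g
    using \<phi>[OF graph_in_K[OF g], of "b g"] graph_base[OF g] fb[OF g] by simp
  ultimately show ?thesis unfolding comp_le_def topspace_eq by auto
qed

end

section \<open>The Roelcke uniformity\<close>

context topological_group
begin

section \<open>Small right translations and right actions\<close>

lemma carrier_nonempty: "carrier G \<noteq> {}"
  using one_closed by auto

lemma small_quotients:
  assumes "openin T N" "\<one> \<in> N"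
  obtains M where "openin T M" "\<one> \<in> M" "\<And>k k'. k \<in> M \<Longrightarrow> k' \<in> M \<Longrightarrow> inv k' \<otimes> k \<in> N"
proof -
  have "continuous_map (prod_topology T T) (prod_topology T T) (\<lambda>(k', k). (inv k', k))"
    using continuous_map_compose[OF continuous_map_fst continuous_inv]
    by (simp add: continuous_map_pairwise o_def case_prod_unfold continuous_map_snd)
  from continuous_map_compose[OF this continuous_mult]
  have c: "continuous_map (prod_topology T T) T (\<lambda>(k', k). inv k' \<otimes> k)"
    by (simp add: o_def case_prod_unfold)
  let ?P = "{p \<in> topspace (prod_topology T T). (\<lambda>(k', k). inv k' \<otimes> k) p \<in> N}"
  have "openin (prod_topology T T) ?P"
    using openin_continuous_map_preimage[OF c assms(1)] .
  moreover have "(\<one>, \<one>) \<in> ?P" using assms(2) topspace_eq by simp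
  ultimately obtain A B where AB: "openin T A" "openin T B" "\<one> \<in> A" "\<one> \<in> B" "A \<times> B \<subseteq> ?P"
    by (rule openin_prod_topologyE)
  have "inv k' \<otimes> k \<in> N" if "k \<in> A \<inter> B" "k' \<in> A \<inter> B" for k k'
    using subsetD[OF AB(5), of "(k', k)"] that by simp
  then show thesis using that[of "A \<inter> B"] AB by auto
qed

text \<open>The point \<open>b (g \<otimes> k')\<close> arises from \<open>b (g \<otimes> k)\<close>
  by letting the small element \<open>inv k' \<otimes> k\<close> act on the right. Such elements
  cannot carry a closed neighbourhood of \<open>y\<close> out of \<open>U\<close>, and the smallness
  required does not depend on \<open>g\<close>.\<close>

lemma right_translates_separated:
  assumes C: "compactification T (X, b)" and a: "action_extension G T (right_act G) (X, b) a"
    and y: "y \<in> topspace X" "y' \<in> topspace X" "y \<noteq> y'"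
  shows "\<exists>N U U'. openin T N \<and> \<one> \<in> N \<and> openin X U \<and> openin X U' \<and> y \<in> U \<and> y' \<in> U' \<and>
        (\<forall>g\<in>carrier G. \<forall>k\<in>N. \<forall>k'\<in>N. \<not> (b (g \<otimes> k) \<in> U \<and> b (g \<otimes> k') \<in> U'))"
proof -
  note C' = compactificationD[OF C]
  have cont: "continuous_map (prod_topology T X) X (\<lambda>(g, x). a g x)"
    and one: "\<And>x. x \<in> topspace X \<Longrightarrow> a \<one> x = x"
    and ab: "\<And>g h. g \<in> carrier G \<Longrightarrow> h \<in> carrier G \<Longrightarrow> a g (b h) = b (h \<otimes> inv g)"
    using a unfolding action_extension_def continuous_action_def right_act_def by simp_all
  obtain U V where UV: "openin X U" "openin X V" "y \<in> U" "y' \<in> V" "disjnt U V"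
    using C'(2) y unfolding Hausdorff_space_def by metis
  have "neighbourhood_base_of (closedin X) X"
    using compact_Hausdorff_imp_regular_space[OF C'(1,2)] neighbourhood_base_of_closedin by auto
  then obtain U1 L where L: "openin X U1" "closedin X L" "y \<in> U1" "U1 \<subseteq> L" "L \<subseteq> U"
    using UV unfolding neighbourhood_base_of by metis
  let ?P = "{p \<in> topspace (prod_topology T X). (\<lambda>(g, x). a g x) p \<in> U}"
  have P: "openin (prod_topology T X) ?P"
    using openin_continuous_map_preimage[OF cont UV(1)] .
  have "a \<one> x \<in> U" if "x \<in> L" for x
    using one[OF subsetD[OF closedin_subset[OF L(2)] that]] subsetD[OF L(5) that] by simp
  then have sub: "{\<one>} \<times> L \<subseteq> ?P"
    using closedin_subset[OF L(2)] topspace_eq by auto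
  have "compactin T {\<one>}" "compactin X L"
    using topspace_eq closedin_compact_space[OF C'(1) L(2)] by simp_all
  \<comment> \<open>Compactness of \<open>L\<close> gives one neighbourhood of the unit that keeps
    all of \<open>L\<close> inside \<open>U\<close>; this is the source of uniformity in
    \<open>g\<close>.\<close>
  from Wallace_theorem_prod_topology[OF this P sub]
  obtain N0 V0 where N0: "openin T N0" "openin X V0" "{\<one>} \<subseteq> N0" "L \<subseteq> V0" "N0 \<times> V0 \<subseteq> ?P" .
  obtain N where N: "openin T N" "\<one> \<in> N" "\<And>k k'. k \<in> N \<Longrightarrow> k' \<in> N \<Longrightarrow> inv k' \<otimes> k \<in> N0"
    using small_quotients[OF N0(1)] N0(3) by auto
  have "\<not> (b (g \<otimes> k) \<in> U1 \<and> b (g \<otimes> k') \<in> V)"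
    if g: "g \<in> carrier G" and k: "k \<in> N" "k' \<in> N" for g k k'
  proof
    assume *: "b (g \<otimes> k) \<in> U1 \<and> b (g \<otimes> k') \<in> V"
    have kc: "k \<in> carrier G" "k' \<in> carrier G" using k openin_subset[OF N(1)] topspace_eq by auto
    have "(inv k' \<otimes> k, b (g \<otimes> k)) \<in> N0 \<times> V0" using N(3)[OF k] * L(4) N0(4) by auto
    then have "a (inv k' \<otimes> k) (b (g \<otimes> k)) \<in> U" using N0(5) by auto
    moreover have "a (inv k' \<otimes> k) (b (g \<otimes> k)) = b (g \<otimes> k')"
    proof -
      have "g \<otimes> k \<otimes> inv (inv k' \<otimes> k) = g \<otimes> k \<otimes> (inv k \<otimes> k')"
        using kc by (simp add: inv_mult_group)
      also have "\<dots> = g \<otimes> k'"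
        using kc g by (simp add: m_assoc inv_solve_left' flip: m_assoc[of k "inv k" k'])
      finally show ?thesis using ab[of "inv k' \<otimes> k" "g \<otimes> k"] kc g by simp
    qed
    ultimately show False using * UV(5) by (auto simp: disjnt_def)
  qed
  then show ?thesis using N L UV(2,4) by (intro exI[of _ N] exI[of _ U1] exI[of _ V]) simp
qed

text \<open>The right action is the left action conjugated by \<open>s\<close>, since
  \<open>inv (g \<otimes> inv h) = h \<otimes> inv g\<close>.\<close>

lemma G_star_imp_lr:
  assumes "G_star_compactification G T C"
  shows "G_lr_compactification G T C"
proof -
  obtain X b where Xb: "C = (X, b)" by (cases C)
  have C: "compactification T (X, b)" and ex: "\<exists>a. action_extension G T (left_act G) (X, b) a"
    and exs: "\<exists>s. continuous_map X X s \<and> (\<forall>x\<in>topspace X. s (s x) = x) \<and>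
            (\<forall>g\<in>carrier G. s (b g) = b (inv g))"
    using assms unfolding Xb G_star_compactification_def G_compactification_def by simp_all
  obtain a where a: "action_extension G T (left_act G) (X, b) a" using ex by auto
  obtain s where s: "continuous_map X X s" "\<And>x. x \<in> topspace X \<Longrightarrow> s (s x) = x"
      "\<And>g. g \<in> carrier G \<Longrightarrow> s (b g) = b (inv g)"
    using exs by auto
  interpret G_compactified G T X b a
    using C a by unfold_locales
  have s_in: "s x \<in> topspace X" if "x \<in> topspace X" for x
    using continuous_map_image_subset_topspace[OF s(1)] that by auto
  have "continuous_map (prod_topology T X) (prod_topology T X) (\<lambda>(g, x). (g, s x))"
    using continuous_map_compose[OF continuous_map_snd s(1)]
    by (simp add: continuous_map_pairwise o_def case_prod_unfold continuous_map_fst)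
  from continuous_map_compose[OF this continuous_map_compose[OF continuous_action s(1)]]
  have "continuous_map (prod_topology T X) X (\<lambda>(g, x). s (a g (s x)))"
    by (simp add: o_def case_prod_unfold)
  then have "continuous_action G T X (\<lambda>g x. s (a g (s x)))"
    unfolding continuous_action_def
    using s_in s(2) action_one action_mult action_in by simp
  moreover have "s (a g (s (b h))) = b (h \<otimes> inv g)" if "g \<in> carrier G" "h \<in> carrier G" for g h
    using that s(3) action_b by (simp add: inv_mult_group)
  ultimately have "action_extension G T (right_act G) (X, b) (\<lambda>g x. s (a g (s x)))"
    unfolding action_extension_def right_act_def by simp
  then show ?thesis unfolding G_lr_compactification_def Xb using C ex by auto
qed

section \<open>Comparison with the Roelcke uniformity\<close>

lemma roelcke_uniformity_iff:
  "v \<in> roelcke_uniformity G T \<longleftrightarrow> is_cover (carrier G) v \<and>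
    (\<exists>N. openin T N \<and> \<one> \<in> N \<and>
      (\<forall>g\<in>carrier G. \<exists>V\<in>v. \<forall>x\<in>N. \<forall>y\<in>N. x \<otimes> g \<otimes> y \<in> V))"
proof -
  have "refines {{x \<otimes> g \<otimes> y | x y. x \<in> N \<and> y \<in> N} | g. g \<in> carrier G} v \<longleftrightarrow>
      (\<forall>g\<in>carrier G. \<exists>V\<in>v. \<forall>x\<in>N. \<forall>y\<in>N. x \<otimes> g \<otimes> y \<in> V)" for N
  proof -
    have "{x \<otimes> g \<otimes> y | x y. x \<in> N \<and> y \<in> N} \<subseteq> V \<longleftrightarrow> (\<forall>x\<in>N. \<forall>y\<in>N. x \<otimes> g \<otimes> y \<in> V)" for g V
      by auto
    moreover have "refines {{x \<otimes> g \<otimes> y | x y. x \<in> N \<and> y \<in> N} | g. g \<in> carrier G} v \<longleftrightarrow>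
      (\<forall>g\<in>carrier G. \<exists>V\<in>v. {x \<otimes> g \<otimes> y | x y. x \<in> N \<and> y \<in> N} \<subseteq> V)"
      unfolding refines_def by auto
    ultimately show ?thesis by simp
  qed
  then show ?thesis
    unfolding roelcke_uniformity_def covers_generated_by_def by auto
qed

text \<open>Multiplying on both sides at once is continuous on \<open>G\<close>, \<open>G\<close>
  and \<open>X\<close> jointly and is the identity at the units. By compactness of \<open>X\<close>
  a single neighbourhood of the unit moves every point only slightly, so the translates of
  \<open>g\<close> from both sides by its elements stay close to \<open>b g\<close>.\<close>

lemma lr_subspace_uniformity_le_roelcke:
  assumes "G_lr_compactification G T (X, b)"
  shows "subspace_uniformity G (X, b) \<subseteq> roelcke_uniformity G T"
proof
  fix v assume v: "v \<in> subspace_uniformity G (X, b)"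
  have C: "compactification T (X, b)"
    using assms unfolding G_lr_compactification_def by simp
  obtain a r where a: "action_extension G T (left_act G) (X, b) a"
    and r: "action_extension G T (right_act G) (X, b) r"
    using assms unfolding G_lr_compactification_def by auto
  interpret G_compactified G T X b a
    using C a by unfold_locales
  have r_cont: "continuous_map (prod_topology T X) X (\<lambda>(g, x). r g x)"
    and r_one: "\<And>x. x \<in> topspace X \<Longrightarrow> r \<one> x = x"
    and rb: "\<And>g h. g \<in> carrier G \<Longrightarrow> h \<in> carrier G \<Longrightarrow> r g (b h) = b (h \<otimes> inv g)"
    using r unfolding action_extension_def continuous_action_def right_act_def by simp_all
  obtain w where w: "open_cover X w" "refines ((\<lambda>W. b -` W \<inter> carrier G) ` w) v"
    and cov: "is_cover (carrier G) v"
    using v unfolding subspace_uniformity_iff[OF C topspace_eq carrier_nonempty] by auto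
  \<comment> \<open>Different pairs of small factors will share different members of
    \<open>w0\<close> with \<open>b g\<close>; the point-star property collects these members in a
    single member of \<open>w\<close>.\<close>
  obtain w0 where w0: "open_cover X w0" "\<And>y. y \<in> topspace X \<Longrightarrow> \<exists>U\<in>w. star y w0 \<subseteq> U"
    using exists_open_point_star_refinement[OF compact Hausdorff w(1)] by metis
  let ?Q = "prod_topology (prod_topology T T) X"
  \<comment> \<open>The inverse undoes the one in \<open>right_act\<close>, so that on the image of
    \<open>G\<close> this is multiplication by \<open>k\<close> on the left and \<open>k'\<close> on
    the right.\<close>
  define m where "m = (\<lambda>((k, k'), x). r (inv k') (a k x))"
  have m: "continuous_map ?Q X m"
  proof -
    have f1: "continuous_map ?Q T (\<lambda>q. fst (fst q))" and f2: "continuous_map ?Q T (\<lambda>q. snd (fst q))"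
      using continuous_map_compose[OF continuous_map_fst continuous_map_fst]
        continuous_map_compose[OF continuous_map_fst continuous_map_snd]
      by (simp_all add: o_def)
    have f3: "continuous_map ?Q T (\<lambda>q. inv (snd (fst q)))"
      using continuous_map_compose[OF f2 continuous_inv] by (simp add: o_def)
    have "continuous_map ?Q X (\<lambda>q. a (fst (fst q)) (snd q))"
      using continuous_map_compose[OF continuous_map_pairedI[OF f1 continuous_map_snd] continuous_action]
      by (simp add: o_def)
    then have "continuous_map ?Q X (\<lambda>q. r (inv (snd (fst q))) (a (fst (fst q)) (snd q)))"
      using continuous_map_compose[OF continuous_map_pairedI[OF f3] r_cont] by (simp add: o_def)
    then show ?thesis unfolding m_def by (simp add: case_prod_unfold)
  qed
  \<comment> \<open>The arguments for which the point and its translate share a member of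
    \<open>w0\<close>. This is an open set containing the slice over the two units, as Wallace's
    theorem requires.\<close>
  define P where "P = (\<Union>W\<in>w0. {q \<in> topspace ?Q. snd q \<in> W} \<inter> {q \<in> topspace ?Q. m q \<in> W})"
  have P_open: "openin ?Q P"
    unfolding P_def
  proof (intro openin_Union ballI; clarify)
    fix W assume "W \<in> w0"
    then have "openin X W" using w0(1) unfolding open_cover_def by simp
    then show "openin ?Q ({q \<in> topspace ?Q. snd q \<in> W} \<inter> {q \<in> topspace ?Q. m q \<in> W})"
      by (intro openin_Int openin_continuous_map_preimage[OF continuous_map_snd]
          openin_continuous_map_preimage[OF m])
  qed
  have P_sub: "{(\<one>, \<one>)} \<times> topspace X \<subseteq> P"
  proof clarify
    fix x assume x: "x \<in> topspace X"
    then obtain W where W: "W \<in> w0" "x \<in> W" using w0(1) unfolding open_cover_def by auto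
    have "m ((\<one>, \<one>), x) = x" unfolding m_def using x action_one r_one by simp
    then show "((\<one>, \<one>), x) \<in> P" unfolding P_def using W x topspace_eq by auto
  qed
  have "compactin (prod_topology T T) {(\<one>, \<one>)}" "compactin X (topspace X)"
    using compact topspace_eq unfolding compact_space_def by simp_all
  from Wallace_theorem_prod_topology[OF this P_open P_sub]
  obtain M V where M: "openin (prod_topology T T) M" "openin X V" "{(\<one>, \<one>)} \<subseteq> M"
      "topspace X \<subseteq> V" "M \<times> V \<subseteq> P" .
  have "(\<one>, \<one>) \<in> M" using M(3) by simp
  from openin_prod_topologyE[OF M(1) this]
  obtain A B where AB: "openin T A" "openin T B" "\<one> \<in> A" "\<one> \<in> B" "A \<times> B \<subseteq> M" .
  have "\<exists>V\<in>v. \<forall>x\<in>A \<inter> B. \<forall>y\<in>A \<inter> B. x \<otimes> g \<otimes> y \<in> V" if g: "g \<in> carrier G" for g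
  proof -
    obtain U where U: "U \<in> w" "star (b g) w0 \<subseteq> U" using w0(2)[OF b_in[OF g]] by auto
    obtain V' where V': "V' \<in> v" "b -` U \<inter> carrier G \<subseteq> V'" using w(2) U(1) unfolding refines_def by auto
    have "x \<otimes> g \<otimes> y \<in> V'" if xy: "x \<in> A \<inter> B" "y \<in> A \<inter> B" for x y
    proof -
      have c: "x \<in> carrier G" "y \<in> carrier G" using xy openin_subset[OF AB(1)] topspace_eq by auto
      have "((x, y), b g) \<in> P" using xy AB(5) M(4,5) b_in[OF g] by auto
      then obtain W where W: "W \<in> w0" "b g \<in> W" "m ((x, y), b g) \<in> W" unfolding P_def by auto
      have "m ((x, y), b g) = b (x \<otimes> g \<otimes> y)"
        unfolding m_def using c g action_b rb by simp
      then have "b (x \<otimes> g \<otimes> y) \<in> star (b g) w0" using W unfolding star_def by auto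
      then show ?thesis using U(2) V'(2) c g by auto
    qed
    then show ?thesis using V'(1) by auto
  qed
  then show "v \<in> roelcke_uniformity G T"
    unfolding roelcke_uniformity_iff using cov AB by (intro conjI exI[of _ "A \<inter> B"]) auto
qed

text \<open>The trace uniformity of \<open>C\<close> is totally bounded and lies in the Roelcke
  uniformity, so it is contained in the finest such uniformity.\<close>

lemma lr_le_roelcke:
  assumes C: "G_lr_compactification G T C" and R: "roelcke_compactification G T R"
  shows "comp_le T C R"
proof -
  obtain X b where X: "C = (X, b)" by (cases C)
  obtain Y c where Y: "R = (Y, c)" by (cases R)
  have X': "compactification T (X, b)"
    using C X unfolding G_lr_compactification_def by simp
  have Y': "compactification T (Y, c)"
    and fin: "finest_totally_bounded_in (carrier G) (roelcke_uniformity G T) (subspace_uniformity G (Y, c))"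
    using R Y unfolding roelcke_compactification_def by simp_all
  have "subspace_uniformity G (X, b) \<subseteq> subspace_uniformity G (Y, c)"
    using fin[unfolded finest_totally_bounded_in_def, THEN conjunct2, THEN conjunct2, rule_format,
        OF conjI[OF totally_bounded_subspace_uniformity[OF X' topspace_eq carrier_nonempty]
          lr_subspace_uniformity_le_roelcke[OF C[unfolded X]]]] .
  then show ?thesis
    unfolding X Y by (rule comp_leI_uniformity[OF X' Y' topspace_eq carrier_nonempty])
qed

end

context G_compactified
begin

section \<open>Lower bounds for the graph compactification\<close>

lemma lr_le_graph:
  assumes "G_lr_compactification G T (X, b)"
  shows "comp_le T (X, b) (subtopology H K, graph)"
proof -
  obtain r where r: "action_extension G T (right_act G) (X, b) r"
    using assms unfolding G_lr_compactification_def by auto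
  show ?thesis
    by (rule comp_le_graphI[where f = "\<lambda>x. x"])
      (use right_translates_separated[OF compactification r] in \<open>simp_all\<close>)
qed

text \<open>The map \<open>f\<close> from the hypothesis collapses the fibres: points with different
  images under \<open>f\<close> are separated by a cover of \<open>Y\<close>, and the Roelcke
  uniformity of its trace forces \<open>c (g \<otimes> k)\<close> and
  \<open>c (g \<otimes> k')\<close> into a common member for small \<open>k\<close>,
  \<open>k'\<close>.\<close>

lemma roelcke_le_graph:
  assumes R: "roelcke_compactification G T (Y, c)" and le: "comp_le T (Y, c) (X, b)"
  shows "comp_le T (Y, c) (subtopology H K, graph)"
proof -
  obtain f where f: "continuous_map X Y f" and fb: "\<And>g. g \<in> carrier G \<Longrightarrow> c g = f (b g)"
    using le unfolding comp_le_def topspace_eq by auto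
  have Y: "compactification T (Y, c)"
    and sub: "subspace_uniformity G (Y, c) \<subseteq> roelcke_uniformity G T"
    using R unfolding roelcke_compactification_def finest_totally_bounded_in_def by simp_all
  note Y' = compactificationD[OF Y]
  show ?thesis
  proof (rule comp_le_graphI[OF f])
    fix y y' assume y: "y \<in> topspace X" "y' \<in> topspace X" "f y \<noteq> f y'"
    have "f y \<in> topspace Y" "f y' \<in> topspace Y"
      using continuous_map_image_subset_topspace[OF f] y by auto
    then obtain w U U' where w: "open_cover Y w" "openin Y U" "openin Y U'" "f y \<in> U" "f y' \<in> U'"
        "\<And>A. A \<in> w \<Longrightarrow> A \<inter> U = {} \<or> A \<inter> U' = {}"
      using compact_separating_open_cover[OF Y'(1,2) _ _ y(3)] by metis
    have "(\<lambda>W. c -` W \<inter> carrier G) ` w \<in> roelcke_uniformity G T"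
      using trace_cover_in_subspace_uniformity[OF Y topspace_eq carrier_nonempty w(1)] sub by auto
    then obtain N where N: "openin T N" "\<one> \<in> N"
        "\<And>g. g \<in> carrier G \<Longrightarrow> \<exists>A\<in>w. \<forall>x\<in>N. \<forall>y\<in>N. x \<otimes> g \<otimes> y \<in> c -` A \<inter> carrier G"
      unfolding roelcke_uniformity_iff by auto
    have "\<not> (b (g \<otimes> k) \<in> {x \<in> topspace X. f x \<in> U} \<and> b (g \<otimes> k') \<in> {x \<in> topspace X. f x \<in> U'})"
      if g: "g \<in> carrier G" and k: "k \<in> N" "k' \<in> N" for g k k'
    proof -
      have kc: "k \<in> carrier G" "k' \<in> carrier G" using k openin_subset[OF N(1)] topspace_eq by auto
      obtain A where A: "A \<in> w" "\<forall>x\<in>N. \<forall>y\<in>N. x \<otimes> g \<otimes> y \<in> c -` A \<inter> carrier G"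
        using N(3)[OF g] by auto
      \<comment> \<open>The left factor in the Roelcke cover is taken to be the unit; only the right
        factors vary.\<close>
      have "c (g \<otimes> k) \<in> A" "c (g \<otimes> k') \<in> A"
        using A(2)[rule_format, OF N(2) k(1)] A(2)[rule_format, OF N(2) k(2)] g by simp_all
      then show ?thesis using w(6)[OF A(1)] fb g kc by auto
    qed
    then show "\<exists>N U U'. openin T N \<and> \<one> \<in> N \<and> openin X U \<and> openin X U' \<and> y \<in> U \<and> y' \<in> U' \<and>
        (\<forall>g\<in>carrier G. \<forall>k\<in>N. \<forall>k'\<in>N. \<not> (b (g \<otimes> k) \<in> U \<and> b (g \<otimes> k') \<in> U'))"
      using N(1,2) y w(4,5) openin_continuous_map_preimage[OF f w(2)]
        openin_continuous_map_preimage[OF f w(3)]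
      by (intro exI[of _ N] exI[of _ "{x \<in> topspace X. f x \<in> U}"]
          exI[of _ "{x \<in> topspace X. f x \<in> U'}"]) simp
  qed (use fb in simp)
qed

end

text \<open>The comparison map is equivariant, because it is so on a dense set. Applied to both
  coordinates it therefore carries graphs to graphs, and by continuity on the hyperspaces closure to
  closure.\<close>

lemma graph_mono:
  fixes G (structure)
  assumes "G_compactified G T X b a" and "G_compactified G T X' b' a'"
    and le: "comp_le T (X, b) (X', b')"
  shows "comp_le T
    (subtopology (G_compactified.H X) (G_compactified.K G X a), G_compactified.graph X a)
    (subtopology (G_compactified.H X') (G_compactified.K G X' a'), G_compactified.graph X' a')"
proof -
  interpret A: G_compactified G T X b a by fact
  interpret B: G_compactified G T X' b' a' by fact
  obtain f where f: "continuous_map X' X f" and fb: "\<And>g. g \<in> carrier G \<Longrightarrow> b g = f (b' g)"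
    using le unfolding comp_le_def A.topspace_eq by auto
  have f_in: "f x \<in> topspace X" if "x \<in> topspace X'" for x
    using continuous_map_image_subset_topspace[OF f] that by auto
  note dense = compactificationD(5)[OF B.compactification]
  have equivariant: "f (a' g x) = a g (f x)" if g: "g \<in> carrier G" and x: "x \<in> topspace X'" for g x
  proof (rule forall_in_closure_of_eq[where X = X' and Y = X and S = "b' ` topspace T"])
    show "x \<in> Abstract_Topology.closure_of X' (b' ` topspace T)" using x dense by simp
    show "Hausdorff_space X" by (rule A.Hausdorff)
    show "continuous_map X' X (\<lambda>x. f (a' g x))"
      using continuous_map_compose[OF B.continuous_action_slice[OF g] f] by (simp add: o_def)
    show "continuous_map X' X (\<lambda>x. a g (f x))"
      using continuous_map_compose[OF f A.continuous_action_slice[OF g]] by (simp add: o_def)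
    fix z assume "z \<in> b' ` topspace T"
    then obtain h where h: "h \<in> carrier G" "z = b' h" using A.topspace_eq by auto
    have "f (a' g z) = b (g \<otimes> h)" using B.action_b[OF g h(1)] fb[of "g \<otimes> h"] g h by simp
    also have "\<dots> = a g (f z)" using A.action_b[OF g h(1)] fb[OF h(1)] h(2) by simp
    finally show "f (a' g z) = a g (f z)" .
  qed
  \<comment> \<open>Without surjectivity the image of a graph could be a proper part of a
    graph.\<close>
  have surj: "f ` topspace X' = topspace X"
  proof
    show "f ` topspace X' \<subseteq> topspace X" using f_in by auto
    have "closedin X (f ` topspace X')"
      using continuous_imp_closed_map[OF f B.compact A.Hausdorff] by (simp add: closed_map_def)
    moreover have "b ` topspace T \<subseteq> f ` topspace X'" using fb B.b_in A.topspace_eq by auto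
    ultimately show "topspace X \<subseteq> f ` topspace X'"
      using closure_of_minimal compactificationD(5)[OF A.compactification] by metis
  qed
  let ?\<phi> = "\<lambda>F. map_prod f f ` F"
  have "continuous_map B.XX A.XX (map_prod f f)"
    using continuous_map_compose[OF continuous_map_fst[of X' X'] f]
      continuous_map_compose[OF continuous_map_snd[of X' X'] f]
    by (simp add: continuous_map_pairwise o_def)
  then have \<phi>: "continuous_map B.H A.H ?\<phi>"
    by (rule continuous_map_vietoris_image_fixed[OF B.compact_XX A.Hausdorff_XX])
  have \<phi>_graph: "?\<phi> (B.graph g) = A.graph g" if g: "g \<in> carrier G" for g
  proof -
    have "?\<phi> (B.graph g) = (\<lambda>x. (f x, f (a' g x))) ` topspace X'"
      unfolding B.graph_def by force
    also have "\<dots> = (\<lambda>x. (f x, a g (f x))) ` topspace X'"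
      using equivariant[OF g] by simp
    also have "\<dots> = (\<lambda>x. (x, a g x)) ` f ` topspace X'" by (simp add: image_image)
    also have "\<dots> = A.graph g" unfolding surj A.graph_def by auto
    finally show ?thesis .
  qed
  have "?\<phi> ` B.K \<subseteq> Abstract_Topology.closure_of A.H (?\<phi> ` B.graph ` carrier G)"
    unfolding B.K_def by (rule continuous_map_image_closure_subset[OF \<phi>])
  also have "?\<phi> ` B.graph ` carrier G = A.graph ` carrier G"
    using \<phi>_graph by (simp add: image_image)
  finally have "?\<phi> ` B.K \<subseteq> A.K" unfolding A.K_def .
  then have "continuous_map (subtopology B.H B.K) (subtopology A.H A.K) ?\<phi>"
    using continuous_map_from_subtopology[OF \<phi>] by (auto simp: continuous_map_in_subtopology)
  then show ?thesis
    unfolding comp_le_def A.topspace_eq using \<phi>_graph by auto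
qed

section \<open>Agreement with the graph compactification\<close>

context G_compactified
begin

text \<open>One half of the criterion, with covers of \<open>X\<close>: each point of the graph of
  \<open>h\<close> over the group has a nearby point of the graph of \<open>g\<close>. The converse
  half is this relation with \<open>g\<close> and \<open>h\<close> exchanged.\<close>

definition uniformly_close_graphs :: "'b set set \<Rightarrow> 'g \<Rightarrow> 'g \<Rightarrow> bool" where
  "uniformly_close_graphs w g h \<longleftrightarrow> (\<forall>y\<in>carrier G. \<exists>x\<in>carrier G. \<exists>B\<in>w. \<exists>C\<in>w.
     b y \<in> B \<and> b x \<in> B \<and> b (h \<otimes> y) \<in> C \<and> b (g \<otimes> x) \<in> C)"

text \<open>Finitely many small boxes cover \<open>F0\<close> and each of them meets it. Sets that
  lie in the union of these boxes and meet every box are close to each other up to the size of a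
  box.\<close>

lemma K_uniform_neighbourhood:
  assumes F0: "F0 \<in> K" and w: "open_cover X w"
  obtains W where "openin H W" "F0 \<in> W"
    "\<And>F F' p. F \<in> W \<Longrightarrow> F' \<in> W \<Longrightarrow> p \<in> F \<Longrightarrow> \<exists>B\<in>w. \<exists>C\<in>w. p \<in> B \<times> C \<and> F' \<inter> B \<times> C \<noteq> {}"
proof -
  let ?S = "{B \<times> C | B C. B \<in> w \<and> C \<in> w}"
  have S_open: "openin XX D" if "D \<in> ?S" for D
    using that w unfolding open_cover_def by (auto simp: openin_prod_Times_iff)
  have F0_sub: "F0 \<subseteq> \<Union>?S"
  proof
    fix p assume "p \<in> F0"
    then have "fst p \<in> \<Union>w" "snd p \<in> \<Union>w"
      using K_point[OF F0] w unfolding open_cover_def by simp_all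
    then obtain B C where "B \<in> w" "C \<in> w" "fst p \<in> B" "snd p \<in> C" by auto
    then show "p \<in> \<Union>?S" by (intro UnionI[of "B \<times> C"]) (auto simp: mem_Times_iff)
  qed
  have "\<exists>\<F>. finite \<F> \<and> \<F> \<subseteq> ?S \<and> F0 \<subseteq> \<Union>\<F>"
    by (rule compactinD[OF closedin_compact_space[OF compact_XX K_closedin[OF F0]] S_open F0_sub])
  then obtain \<F> where \<F>: "finite \<F>" "\<F> \<subseteq> ?S" "F0 \<subseteq> \<Union>\<F>" by (elim exE conjE)
  \<comment> \<open>Boxes missed by \<open>F0\<close> are discarded, since hitting all the remaining
    ones has to be true of \<open>F0\<close> itself.\<close>
  define \<D> where "\<D> = {D \<in> \<F>. F0 \<inter> D \<noteq> {}}"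
  have \<D>: "finite \<D>" "\<D> \<subseteq> ?S" using \<F> unfolding \<D>_def by auto
  \<comment> \<open>Intersecting with the whole hyperspace covers the case of no boxes, which occurs
    for empty \<open>F0\<close>.\<close>
  define W where "W = {F. closedin XX F \<and> F \<subseteq> \<Union>\<D>} \<inter>
    ((\<Inter>D\<in>\<D>. {F. closedin XX F \<and> F \<inter> D \<noteq> {}}) \<inter> topspace H)"
  have D_open: "openin XX D" if "D \<in> \<D>" for D
    using S_open subsetD[OF \<D>(2) that] by simp
  have "openin H W"
    unfolding W_def
  proof (rule openin_Int)
    show "openin H {F. closedin XX F \<and> F \<subseteq> \<Union>\<D>}"
      using D_open by (intro openin_vietoris_subset openin_Union) simp
    show "openin H ((\<Inter>D\<in>\<D>. {F. closedin XX F \<and> F \<inter> D \<noteq> {}}) \<inter> topspace H)"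
      using \<D>(1) openin_vietoris_hit[OF D_open] by (rule openin_INT)
  qed
  moreover have "F0 \<in> W"
    unfolding W_def topspace_vietoris using K_closedin[OF F0] \<F>(3) by (auto simp: \<D>_def)
  moreover have "\<exists>B\<in>w. \<exists>C\<in>w. p \<in> B \<times> C \<and> F' \<inter> B \<times> C \<noteq> {}"
    if "F \<in> W" "F' \<in> W" "p \<in> F" for F F' p
  proof -
    have "p \<in> \<Union>\<D>" using that unfolding W_def by auto
    then obtain D where D: "D \<in> \<D>" "p \<in> D" by auto
    then obtain B C where "B \<in> w" "C \<in> w" "D = B \<times> C" using subsetD[OF \<D>(2) D(1)] by auto
    moreover have "F' \<inter> D \<noteq> {}" using that(2) D(1) unfolding W_def by auto
    ultimately show ?thesis using D(2) by auto
  qed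
  ultimately show thesis by (rule that)
qed

text \<open>The comparison map pulls the neighbourhoods of uniformly close members of
  \<open>K\<close> back to an open cover of \<open>X\<close>; elements with images in one member
  have graphs in one such neighbourhood.\<close>

lemma graph_le_imp_uniformly_close_graphs:
  assumes le: "comp_le T (subtopology H K, graph) (X, b)" and w: "open_cover X w"
  obtains w' where "open_cover X w'"
    "\<And>A g h. A \<in> w' \<Longrightarrow> g \<in> carrier G \<Longrightarrow> h \<in> carrier G \<Longrightarrow> b g \<in> A \<Longrightarrow> b h \<in> A \<Longrightarrow>
      uniformly_close_graphs w g h"
proof -
  obtain \<phi> where \<phi>: "continuous_map X (subtopology H K) \<phi>"
    and \<phi>b: "\<And>g. g \<in> carrier G \<Longrightarrow> graph g = \<phi> (b g)"
    using le unfolding comp_le_def topspace_eq by auto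
  have \<phi>H: "continuous_map X H \<phi>" and \<phi>_in: "\<And>x. x \<in> topspace X \<Longrightarrow> \<phi> x \<in> K"
    using \<phi> unfolding continuous_map_in_subtopology by auto
  have "\<forall>F0\<in>K. \<exists>W. openin H W \<and> F0 \<in> W \<and> (\<forall>F\<in>W. \<forall>F'\<in>W. \<forall>p\<in>F. \<exists>B\<in>w. \<exists>C\<in>w.
      p \<in> B \<times> C \<and> F' \<inter> B \<times> C \<noteq> {})"
  proof
    fix F0 assume "F0 \<in> K"
    from K_uniform_neighbourhood[OF this w]
    show "\<exists>W. openin H W \<and> F0 \<in> W \<and> (\<forall>F\<in>W. \<forall>F'\<in>W. \<forall>p\<in>F. \<exists>B\<in>w. \<exists>C\<in>w.
      p \<in> B \<times> C \<and> F' \<inter> B \<times> C \<noteq> {})" by metis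
  qed
  from bchoice[OF this]
  obtain W where W0: "\<forall>F0\<in>K. openin H (W F0) \<and> F0 \<in> W F0 \<and> (\<forall>F\<in>W F0. \<forall>F'\<in>W F0. \<forall>p\<in>F.
      \<exists>B\<in>w. \<exists>C\<in>w. p \<in> B \<times> C \<and> F' \<inter> B \<times> C \<noteq> {})"
    by (elim exE)
  have W: "\<And>F0. F0 \<in> K \<Longrightarrow> openin H (W F0)" "\<And>F0. F0 \<in> K \<Longrightarrow> F0 \<in> W F0"
    "\<And>F0 F F' p. F0 \<in> K \<Longrightarrow> F \<in> W F0 \<Longrightarrow> F' \<in> W F0 \<Longrightarrow> p \<in> F \<Longrightarrow>
      \<exists>B\<in>w. \<exists>C\<in>w. p \<in> B \<times> C \<and> F' \<inter> B \<times> C \<noteq> {}"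
    using W0 by (simp_all del: mem_Times_iff)
  let ?P = "\<lambda>F0. {x \<in> topspace X. \<phi> x \<in> W F0}"
  have "open_cover X (?P ` K)"
    unfolding open_cover_def
  proof
    show "\<forall>A\<in>?P ` K. openin X A"
      using openin_continuous_map_preimage[OF \<phi>H W(1)] by simp
    have "x \<in> \<Union>(?P ` K)" if "x \<in> topspace X" for x
      using that \<phi>_in[OF that] W(2)[OF \<phi>_in[OF that]] by (intro UN_I[of "\<phi> x"]) simp_all
    then show "\<Union>(?P ` K) = topspace X" by (intro subset_antisym) auto
  qed
  moreover have "uniformly_close_graphs w g h"
    if A: "A \<in> ?P ` K" and gh: "g \<in> carrier G" "h \<in> carrier G" "b g \<in> A" "b h \<in> A" for A g h
    unfolding uniformly_close_graphs_def
  proof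
    fix y assume y: "y \<in> carrier G"
    obtain F0 where F0: "F0 \<in> K" "A = ?P F0" using A by auto
    have "graph g \<in> W F0" "graph h \<in> W F0" using gh F0(2) \<phi>b by simp_all
    moreover have "(b y, b (h \<otimes> y)) \<in> graph h" using graph_b_iff[OF gh(2) y] by simp
    ultimately obtain B C where BC: "B \<in> w" "C \<in> w" "(b y, b (h \<otimes> y)) \<in> B \<times> C"
        "graph g \<inter> B \<times> C \<noteq> {}"
      using W(3)[OF F0(1), of "graph h" "graph g" "(b y, b (h \<otimes> y))"] by metis
    \<comment> \<open>The point of the graph of \<open>g\<close> in the box need not lie over the
      group; openness of the box lets density replace it by one that does.\<close>
    have "openin X B" "openin X C" using w BC(1,2) unfolding open_cover_def by simp_all
    then obtain x where x: "x \<in> carrier G" "b x \<in> B" "b (g \<otimes> x) \<in> C"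
      using graph_hits_open[OF gh(1) _ _ BC(4)] by metis
    show "\<exists>x\<in>carrier G. \<exists>B\<in>w. \<exists>C\<in>w. b y \<in> B \<and> b x \<in> B \<and> b (h \<otimes> y) \<in> C \<and> b (g \<otimes> x) \<in> C"
      using x BC by (intro bexI[of _ x] bexI[of _ B] bexI[of _ C]) simp_all
  qed
  ultimately show thesis by (rule that)
qed

text \<open>Guarantees that whatever is close to a point of \<open>Q\<close> lies in the closed set
  \<open>M\<close>: the cover is a neighbourhood \<open>V\<close> inside \<open>M\<close> and the
  complement of a closed set containing \<open>Q\<close>, so a member meeting \<open>Q\<close> must
  be \<open>V\<close>.\<close>

lemma exists_star_small_cover:
  assumes P: "openin X P" and p: "p \<in> P"
  obtains Q M w where "openin X Q" "closedin X M" "p \<in> Q" "M \<subseteq> P" "open_cover X w"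
    "\<And>A. A \<in> w \<Longrightarrow> A \<inter> Q \<noteq> {} \<Longrightarrow> A \<subseteq> M"
proof -
  have reg: "neighbourhood_base_of (closedin X) X"
    using compact_Hausdorff_imp_regular_space[OF compact Hausdorff] neighbourhood_base_of_closedin
    by auto
  obtain V M where M: "openin X V" "closedin X M" "p \<in> V" "V \<subseteq> M" "M \<subseteq> P"
    using reg P p unfolding neighbourhood_base_of by metis
  obtain Q L where L: "openin X Q" "closedin X L" "p \<in> Q" "Q \<subseteq> L" "L \<subseteq> V"
    using reg M(1,3) unfolding neighbourhood_base_of by metis
  have "open_cover X {V, topspace X - L}"
    using L M(1) openin_subset[OF M(1)] unfolding open_cover_def by auto
  moreover have "A \<subseteq> M" if "A \<in> {V, topspace X - L}" "A \<inter> Q \<noteq> {}" for A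
    using that L(4) M(4) by auto
  ultimately show thesis using that L(1,3) M(2,5) by metis
qed

text \<open>Around a point of \<open>F\<close> outside \<open>F'\<close> there are a small open box
  and a larger closed box that misses \<open>F'\<close>. If the graph of \<open>h\<close> hits the
  small box, a close graph of \<open>g\<close> hits the larger one and so cannot lie in its
  complement, which is a neighbourhood of \<open>F'\<close>.\<close>

lemma uniformly_close_graphs_separate:
  assumes close: "\<And>w. open_cover X w \<Longrightarrow> \<exists>w'. open_cover X w' \<and>
      (\<forall>A\<in>w'. \<forall>g\<in>carrier G. \<forall>h\<in>carrier G. b g \<in> A \<and> b h \<in> A \<longrightarrow> uniformly_close_graphs w g h)"
    and F: "F \<in> K" "F' \<in> K" and p: "p \<in> F" "p \<notin> F'"
  obtains w' U U' where "open_cover X w'" "openin H U" "openin H U'" "F \<in> U" "F' \<in> U'"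
    "\<And>A g h. A \<in> w' \<Longrightarrow> g \<in> carrier G \<Longrightarrow> h \<in> carrier G \<Longrightarrow> b g \<in> A \<Longrightarrow> b h \<in> A \<Longrightarrow>
      graph h \<in> U \<Longrightarrow> graph g \<notin> U'"
proof -
  obtain p1 p2 where p12: "p = (p1, p2)" by (cases p)
  have "openin XX (topspace XX - F')"
    by (rule openin_diff[OF openin_topspace K_closedin[OF F(2)]])
  moreover have "(p1, p2) \<in> topspace XX - F'" using K_point[OF F(1) p(1)] p(2) p12 by simp
  ultimately obtain P1 P2 where P: "openin X P1" "openin X P2" "p1 \<in> P1" "p2 \<in> P2"
      "P1 \<times> P2 \<subseteq> topspace XX - F'"
    by (rule openin_prod_topologyE)
  obtain Q1 M1 w1 where 1: "openin X Q1" "closedin X M1" "p1 \<in> Q1" "M1 \<subseteq> P1" "open_cover X w1"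
      "\<And>A. A \<in> w1 \<Longrightarrow> A \<inter> Q1 \<noteq> {} \<Longrightarrow> A \<subseteq> M1"
    using exists_star_small_cover[OF P(1,3)] by metis
  obtain Q2 M2 w2 where 2: "openin X Q2" "closedin X M2" "p2 \<in> Q2" "M2 \<subseteq> P2" "open_cover X w2"
      "\<And>A. A \<in> w2 \<Longrightarrow> A \<inter> Q2 \<noteq> {} \<Longrightarrow> A \<subseteq> M2"
    using exists_star_small_cover[OF P(2,4)] by metis
  \<comment> \<open>Closeness of graphs measures both coordinates with the same cover, so one cover
    must be fine enough for both factors of the box.\<close>
  obtain w where w: "open_cover X w" "star_refines w w1" "star_refines w w2"
    using exists_common_open_star_refinement[OF compact Hausdorff 1(5) 2(5)] by metis
  have w_small: "A \<subseteq> M" if A: "A \<in> w" "A \<inter> Q \<noteq> {}" and u: "star_refines w u"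
    and small: "\<And>A. A \<in> u \<Longrightarrow> A \<inter> Q \<noteq> {} \<Longrightarrow> A \<subseteq> M" for A Q M u
  proof -
    obtain B where B: "B \<in> u" "\<And>V. V \<in> w \<Longrightarrow> V \<inter> A \<noteq> {} \<Longrightarrow> V \<subseteq> B"
      using star_refinesD[OF u A(1)] by metis
    have "A \<subseteq> B" using B(2)[OF A(1)] A(2) by auto
    then show ?thesis using small[OF B(1)] A(2) by blast
  qed
  obtain w' where w': "open_cover X w'" "\<And>A g h. A \<in> w' \<Longrightarrow> g \<in> carrier G \<Longrightarrow> h \<in> carrier G \<Longrightarrow>
      b g \<in> A \<Longrightarrow> b h \<in> A \<Longrightarrow> uniformly_close_graphs w g h"
    using close[OF w(1)] by auto
  define U where "U = {F. closedin XX F \<and> F \<inter> Q1 \<times> Q2 \<noteq> {}}"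
  define U' where "U' = {F. closedin XX F \<and> F \<subseteq> topspace XX - M1 \<times> M2}"
  have "openin H U"
    unfolding U_def using 1(1) 2(1) by (intro openin_vietoris_hit) (simp add: openin_prod_Times_iff)
  moreover have "openin H U'"
    unfolding U'_def
  proof (intro openin_vietoris_subset openin_diff openin_topspace)
    show "closedin XX (M1 \<times> M2)" using 1(2) 2(2) by (simp add: closedin_prod_Times_iff)
  qed
  moreover have "F \<in> U" unfolding U_def using K_closedin[OF F(1)] p(1) p12 1(3) 2(3) by auto
  moreover have "F' \<in> U'"
  proof -
    have "M1 \<times> M2 \<subseteq> P1 \<times> P2" using 1(4) 2(4) by auto
    then have "F' \<inter> M1 \<times> M2 = {}" using P(5) by auto
    then show ?thesis unfolding U'_def using K_closedin[OF F(2)] closedin_subset[OF K_closedin[OF F(2)]] by auto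
  qed
  moreover have "graph g \<notin> U'"
    if A: "A \<in> w'" and gh: "g \<in> carrier G" "h \<in> carrier G" "b g \<in> A" "b h \<in> A"
      and hU: "graph h \<in> U" for A g h
  proof
    assume gU': "graph g \<in> U'"
    have "graph h \<inter> Q1 \<times> Q2 \<noteq> {}" using hU unfolding U_def by simp
    then obtain y where y: "y \<in> carrier G" "b y \<in> Q1" "b (h \<otimes> y) \<in> Q2"
      using graph_hits_open[OF gh(2) 1(1) 2(1)] by metis
    obtain x B C where x: "x \<in> carrier G" "B \<in> w" "C \<in> w" "b y \<in> B" "b x \<in> B" "b (h \<otimes> y) \<in> C"
        "b (g \<otimes> x) \<in> C"
      using w'(2)[OF A gh] y(1) unfolding uniformly_close_graphs_def by metis
    have "B \<inter> Q1 \<noteq> {}" "C \<inter> Q2 \<noteq> {}" using x(4,6) y(2,3) by auto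
    then have "B \<subseteq> M1" "C \<subseteq> M2"
      using w_small[OF x(2) _ w(2) 1(6)] w_small[OF x(3) _ w(3) 2(6)] by simp_all
    then have "(b x, b (g \<otimes> x)) \<in> M1 \<times> M2" using x(5,7) by auto
    moreover have "(b x, b (g \<otimes> x)) \<in> graph g" using graph_b_iff[OF gh(1) x(1)] by simp
    ultimately show False using gU' unfolding U'_def by auto
  qed
  ultimately show thesis using that w'(1) by metis
qed

text \<open>Closeness supplies the separation needed to map \<open>X\<close> into \<open>K\<close>:
  around any point of \<open>X\<close> a member of the pulled-back scale keeps graphs from
  approaching two different limits.\<close>

lemma uniformly_close_graphs_imp_graph_le:
  assumes close: "\<And>w. open_cover X w \<Longrightarrow> \<exists>w'. open_cover X w' \<and>
      (\<forall>A\<in>w'. \<forall>g\<in>carrier G. \<forall>h\<in>carrier G. b g \<in> A \<and> b h \<in> A \<longrightarrow> uniformly_close_graphs w g h)"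
  shows "comp_le T (subtopology H K, graph) (X, b)"
proof (rule comp_leI[OF compactification_graph compactification])
  fix z F F' assume z: "z \<in> topspace X" and F: "F \<in> topspace (subtopology H K)"
    "F' \<in> topspace (subtopology H K)" "F \<noteq> F'"
  then have FK: "F \<in> K" "F' \<in> K" unfolding topspace_K by simp_all
  have "\<exists>w' U U'. open_cover X w' \<and> openin H U \<and> openin H U' \<and> F \<in> U \<and> F' \<in> U' \<and>
    (\<forall>A\<in>w'. \<forall>g\<in>carrier G. \<forall>h\<in>carrier G. b g \<in> A \<longrightarrow> b h \<in> A \<longrightarrow> graph g \<in> U \<longrightarrow> graph h \<notin> U')"
  \<comment> \<open>Separation starts from a point in one set but not in the other. Which set has it
    is unknown, so in the second case the neighbourhoods and the elements \<open>g\<close>,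
    \<open>h\<close> change places; the closeness assumption holds for both orders.\<close>
  proof (cases "F \<subseteq> F'")
    case False
    then obtain p where "p \<in> F" "p \<notin> F'" by auto
    from uniformly_close_graphs_separate[OF close FK this]
    obtain w' U U' where "open_cover X w'" "openin H U" "openin H U'" "F \<in> U" "F' \<in> U'"
      "\<And>A g h. A \<in> w' \<Longrightarrow> g \<in> carrier G \<Longrightarrow> h \<in> carrier G \<Longrightarrow> b g \<in> A \<Longrightarrow> b h \<in> A \<Longrightarrow>
      graph h \<in> U \<Longrightarrow> graph g \<notin> U'" by blast
    then show ?thesis by (intro exI[of _ w'] exI[of _ U] exI[of _ U']) simp
  next
    case True
    then obtain p where "p \<in> F'" "p \<notin> F" using F(3) by auto
    from uniformly_close_graphs_separate[OF close FK(2,1) this]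
    obtain w' U U' where "open_cover X w'" "openin H U" "openin H U'" "F' \<in> U" "F \<in> U'"
      "\<And>A g h. A \<in> w' \<Longrightarrow> g \<in> carrier G \<Longrightarrow> h \<in> carrier G \<Longrightarrow> b g \<in> A \<Longrightarrow> b h \<in> A \<Longrightarrow>
      graph h \<in> U \<Longrightarrow> graph g \<notin> U'" by blast
    then show ?thesis by (intro exI[of _ w'] exI[of _ U'] exI[of _ U]) auto
  qed
  then obtain w' U U' where w': "open_cover X w'" "openin H U" "openin H U'" "F \<in> U" "F' \<in> U'"
    "\<And>A g h. A \<in> w' \<Longrightarrow> g \<in> carrier G \<Longrightarrow> h \<in> carrier G \<Longrightarrow> b g \<in> A \<Longrightarrow> b h \<in> A \<Longrightarrow>
      graph g \<in> U \<Longrightarrow> graph h \<notin> U'" by auto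
  have "z \<in> \<Union>w'" using w'(1) z unfolding open_cover_def by simp
  then obtain A where A: "A \<in> w'" "z \<in> A" by auto
  then have "openin X A" using w'(1) unfolding open_cover_def by simp
  then show "\<exists>W V V'. openin X W \<and> openin (subtopology H K) V \<and> openin (subtopology H K) V' \<and>
      z \<in> W \<and> F \<in> V \<and> F' \<in> V' \<and> (\<forall>g\<in>topspace T. \<forall>h\<in>topspace T. b g \<in> W \<and> b h \<in> W \<longrightarrow>
        \<not> (graph g \<in> V \<and> graph h \<in> V'))"
    using A w'(2-5) w'(6)[OF A(1)] FK topspace_eq
    by (intro exI[of _ A] exI[of _ "U \<inter> K"] exI[of _ "U' \<inter> K"]) (auto simp: openin_subtopology)
qed

section \<open>The criterion in terms of stars in the group\<close>

lemma star_trace_iff: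
  assumes "x \<in> carrier G" "y \<in> carrier G"
  shows "y \<in> star x ((\<lambda>W. b -` W \<inter> carrier G) ` w) \<longleftrightarrow> (\<exists>B\<in>w. b x \<in> B \<and> b y \<in> B)"
  unfolding star_def using assms by auto

lemma uniformly_close_graphs_iff:
  assumes "g \<in> carrier G" "h \<in> carrier G"
  defines "u \<equiv> \<lambda>w. (\<lambda>W. b -` W \<inter> carrier G) ` w"
  shows "uniformly_close_graphs w g h \<longleftrightarrow>
    (\<forall>y\<in>carrier G. \<exists>x\<in>carrier G. y \<in> star x (u w) \<and> h \<otimes> y \<in> star (g \<otimes> x) (u w))"
proof -
  have "(\<exists>B\<in>w. \<exists>C\<in>w. b y \<in> B \<and> b x \<in> B \<and> b (h \<otimes> y) \<in> C \<and> b (g \<otimes> x) \<in> C) \<longleftrightarrow>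
    y \<in> star x (u w) \<and> h \<otimes> y \<in> star (g \<otimes> x) (u w)"
    if "x \<in> carrier G" "y \<in> carrier G" for x y
    unfolding u_def using that assms star_trace_iff[of x y w] star_trace_iff[of "g \<otimes> x" "h \<otimes> y" w]
    by auto
  then show ?thesis unfolding uniformly_close_graphs_def by simp
qed

text \<open>Passes between open covers of \<open>X\<close> and uniform covers of \<open>G\<close>:
  every uniform cover is refined by the trace of an open cover, every such trace is uniform, and
  stars grow along refinement.\<close>

lemma graph_le_iff:
  "comp_le T (subtopology H K, graph) (X, b) \<longleftrightarrow>
    (\<forall>u\<in>subspace_uniformity G (X, b). \<exists>v\<in>subspace_uniformity G (X, b).
      \<forall>g\<in>carrier G. \<forall>h\<in>carrier G. g \<in> star h v \<longrightarrow>
        (\<forall>y\<in>carrier G. \<exists>x\<in>carrier G. y \<in> star x u \<and> h \<otimes> y \<in> star (g \<otimes> x) u) \<and>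
        (\<forall>x\<in>carrier G. \<exists>y\<in>carrier G. x \<in> star y u \<and> g \<otimes> x \<in> star (h \<otimes> y) u))"
    (is "?le \<longleftrightarrow> (\<forall>u\<in>?\<U>. \<exists>v\<in>?\<U>. ?Q u v)")
proof
  let ?t = "\<lambda>w. (\<lambda>W. b -` W \<inter> carrier G) ` w"
  note uniformity = subspace_uniformity_iff[OF compactification topspace_eq carrier_nonempty]
  note trace_in = trace_cover_in_subspace_uniformity[OF compactification topspace_eq carrier_nonempty]
  {
    assume le: ?le
    show "\<forall>u\<in>?\<U>. \<exists>v\<in>?\<U>. ?Q u v"
    proof
      fix u assume "u \<in> ?\<U>"
      then obtain w where w: "open_cover X w" "refines (?t w) u"
        unfolding uniformity by auto
      obtain w' where w': "open_cover X w'" "\<And>A g h. A \<in> w' \<Longrightarrow> g \<in> carrier G \<Longrightarrow> h \<in> carrier G \<Longrightarrow>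
          b g \<in> A \<Longrightarrow> b h \<in> A \<Longrightarrow> uniformly_close_graphs w g h"
        using graph_le_imp_uniformly_close_graphs[OF le w(1)] by blast
      have half: "\<forall>y\<in>carrier G. \<exists>x\<in>carrier G. y \<in> star x u \<and> h \<otimes> y \<in> star (g \<otimes> x) u"
        if gh: "g \<in> carrier G" "h \<in> carrier G" "g \<in> star h (?t w')" for g h
      proof
        fix y assume y: "y \<in> carrier G"
        obtain A where "A \<in> w'" "b g \<in> A" "b h \<in> A"
          using gh(3) unfolding star_trace_iff[OF gh(2,1)] by auto
        then have "uniformly_close_graphs w g h" using w'(2) gh(1,2) by simp
        then obtain x where x: "x \<in> carrier G" "y \<in> star x (?t w)" "h \<otimes> y \<in> star (g \<otimes> x) (?t w)"
          unfolding uniformly_close_graphs_iff[OF gh(1,2)] using y by auto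
        show "\<exists>x\<in>carrier G. y \<in> star x u \<and> h \<otimes> y \<in> star (g \<otimes> x) u"
          using x subsetD[OF star_mono[OF w(2)]] by (intro bexI[of _ x]) simp_all
      qed
      \<comment> \<open>The second half of the criterion is \<open>half\<close> for the exchanged
        pair, which is admissible because stars are symmetric.\<close>
      have "?Q u (?t w')"
        using half star_sym[of _ _ "?t w'"] by simp
      then show "\<exists>v\<in>?\<U>. ?Q u v" using trace_in[OF w'(1)] by (rule bexI)
    qed
  }
  {
    assume Q: "\<forall>u\<in>?\<U>. \<exists>v\<in>?\<U>. ?Q u v"
    show ?le
    proof (rule uniformly_close_graphs_imp_graph_le)
      fix w assume w: "open_cover X w"
      obtain v where v: "v \<in> ?\<U>" "?Q (?t w) v" using bspec[OF Q trace_in[OF w]] by (elim bexE)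
      obtain w' where w': "open_cover X w'" "refines (?t w') v"
        using v(1) unfolding uniformity by auto
      have "uniformly_close_graphs w g h"
        if "A \<in> w'" "g \<in> carrier G" "h \<in> carrier G" "b g \<in> A" "b h \<in> A" for A g h
      proof -
        have "g \<in> star h (?t w')" using that star_trace_iff by auto
        then have "g \<in> star h v" using star_mono[OF w'(2)] by auto
        then show ?thesis
          unfolding uniformly_close_graphs_iff[OF that(2,3)]
          using v(2)[rule_format, OF that(2,3)] by simp
      qed
      then show "\<exists>w'. open_cover X w' \<and> (\<forall>A\<in>w'. \<forall>g\<in>carrier G. \<forall>h\<in>carrier G.
          b g \<in> A \<and> b h \<in> A \<longrightarrow> uniformly_close_graphs w g h)"
        using w'(1) by (intro exI[of _ w']) simp
    qed
  }
qed

end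

section \<open>Transfer to the chosen extended action\<close>

lemma G_compactified_extended_action:
  assumes "topological_group G T" "G_compactification G T (X, b)"
  shows "G_compactified G T X b (extended_action G T (X, b))"
proof -
  have C: "compactification T (X, b)" and ex: "\<exists>a. action_extension G T (left_act G) (X, b) a"
    using assms(2) unfolding G_compactification_def by simp_all
  have "action_extension G T (left_act G) (X, b) (extended_action G T (X, b))"
    unfolding extended_action_def using ex by (rule someI_ex)
  then show ?thesis
    using assms(1) C by (intro G_compactified.intro G_compactified_axioms.intro)
qed

lemma graph_compactification_eq:
  assumes "G_compactified G T X b (extended_action G T (X, b))"
  shows "graph_compactification G T (X, b) =
    (subtopology (G_compactified.H X) (G_compactified.K G X (extended_action G T (X, b))),
      G_compactified.graph X (extended_action G T (X, b)))"
proof -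
  interpret G_compactified G T X b "extended_action G T (X, b)" by fact
  have "graph_map G T (X, b) = graph"
    unfolding graph_map_def graph_def by (simp add: fun_eq_iff)
  then show ?thesis
    unfolding graph_compactification_def K_def Let_def by simp
qed

context topological_group
begin

lemma G_star_graph_compactification:
  assumes "G_compactification G T C"
  shows "G_star_compactification G T (graph_compactification G T C)"
proof -
  obtain X b where C: "C = (X, b)" by (cases C)
  note L = G_compactified_extended_action[OF topological_group_axioms assms[unfolded C]]
  show ?thesis
    unfolding C graph_compactification_eq[OF L] by (rule G_compactified.G_star_graph[OF L])
qed

lemma graph_compactification_mono:
  assumes "G_compactification G T C" "G_compactification G T C'" "comp_le T C C'"
  shows "comp_le T (graph_compactification G T C) (graph_compactification G T C')"
proof -
  obtain X b where C: "C = (X, b)" by (cases C)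
  obtain X' b' where C': "C' = (X', b')" by (cases C')
  note L = G_compactified_extended_action[OF topological_group_axioms assms(1)[unfolded C]]
    and L' = G_compactified_extended_action[OF topological_group_axioms assms(2)[unfolded C']]
  show ?thesis
    unfolding C C' graph_compactification_eq[OF L] graph_compactification_eq[OF L']
    by (rule graph_mono[OF L L' assms(3)[unfolded C C']])
qed

lemma
  assumes lr: "G_lr_compactification G T C"
  shows lr_le_graph_compactification: "comp_le T C (graph_compactification G T C)"
    and graph_compactification_eq_iff: "comp_eq T (graph_compactification G T C) C \<longleftrightarrow>
      (\<forall>u\<in>subspace_uniformity G C. \<exists>v\<in>subspace_uniformity G C.
        \<forall>g\<in>carrier G. \<forall>h\<in>carrier G. g \<in> star h v \<longrightarrow>
          (\<forall>y\<in>carrier G. \<exists>x\<in>carrier G. y \<in> star x u \<and> h \<otimes> y \<in> star (g \<otimes> x) u) \<and>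
          (\<forall>x\<in>carrier G. \<exists>y\<in>carrier G. x \<in> star y u \<and> g \<otimes> x \<in> star (h \<otimes> y) u))"
proof -
  obtain X b where C: "C = (X, b)" by (cases C)
  have "G_compactification G T (X, b)"
    using lr C unfolding G_lr_compactification_def G_compactification_def by simp
  note L = G_compactified_extended_action[OF topological_group_axioms this]
  show le: "comp_le T C (graph_compactification G T C)"
    unfolding C graph_compactification_eq[OF L]
    by (rule G_compactified.lr_le_graph[OF L lr[unfolded C]])
  \<comment> \<open>The reverse inequality is already known for two-sided compactifications, so only
    one comparison is left to characterise.\<close>
  have eq: "comp_eq T (graph_compactification G T C) C \<longleftrightarrow> comp_le T (graph_compactification G T C) C"
    unfolding comp_eq_def using le by simp
  show "comp_eq T (graph_compactification G T C) C \<longleftrightarrow>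
      (\<forall>u\<in>subspace_uniformity G C. \<exists>v\<in>subspace_uniformity G C.
        \<forall>g\<in>carrier G. \<forall>h\<in>carrier G. g \<in> star h v \<longrightarrow>
          (\<forall>y\<in>carrier G. \<exists>x\<in>carrier G. y \<in> star x u \<and> h \<otimes> y \<in> star (g \<otimes> x) u) \<and>
          (\<forall>x\<in>carrier G. \<exists>y\<in>carrier G. x \<in> star y u \<and> g \<otimes> x \<in> star (h \<otimes> y) u))"
    unfolding eq unfolding C graph_compactification_eq[OF L]
    by (rule G_compactified.graph_le_iff[OF L])
qed

lemma
  assumes C: "G_compactification G T C" and R: "roelcke_compactification G T R"
  shows graph_compactification_le_roelcke: "comp_le T (graph_compactification G T C) R"
    and graph_compactification_eq_roelcke:
      "comp_le T R C \<Longrightarrow> comp_eq T (graph_compactification G T C) R"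
proof -
  show le: "comp_le T (graph_compactification G T C) R"
    \<comment> \<open>The compactification by graphs carries both actions even when \<open>C\<close>
      carries only the left one, so the bound for two-sided compactifications applies to it.\<close>
    by (rule lr_le_roelcke[OF G_star_imp_lr[OF G_star_graph_compactification[OF C]] R])
  obtain X b where Xb: "C = (X, b)" by (cases C)
  obtain Y c where Yc: "R = (Y, c)" by (cases R)
  note L = G_compactified_extended_action[OF topological_group_axioms C[unfolded Xb]]
  assume "comp_le T R C"
  then have "comp_le T R (graph_compactification G T C)"
    unfolding Xb Yc graph_compactification_eq[OF L]
    by (rule G_compactified.roelcke_le_graph[OF L R[unfolded Yc]])
  then show "comp_eq T (graph_compactification G T C) R"
    unfolding comp_eq_def using le by simp
qed

end

text \<open>The first conjunct says that the values of the method of graphs are self-inverse, as its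
  codomain demands. Passing to relations changes the type of the points, so equality of
  compactifications is \<open>comp_eq\<close>.\<close>

theorem theorem5p7:
  fixes G :: "('g, 'm) monoid_scheme" and T :: "'g topology"
  assumes "topological_group G T"
  shows
    "(\<forall>C :: ('g, 'b) compactification. G_compactification G T C \<longrightarrow>
        G_star_compactification G T (graph_compactification G T C)) \<and>
     (\<forall>(C :: ('g, 'b) compactification) (C' :: ('g, 'c) compactification).
        G_compactification G T C \<and> G_compactification G T C' \<and> comp_le T C C' \<longrightarrow>
        comp_le T (graph_compactification G T C) (graph_compactification G T C')) \<and>
     (\<forall>C :: ('g, 'b) compactification. G_lr_compactification G T C \<longrightarrow>
        comp_le T C (graph_compactification G T C)) \<and>
     (\<forall>(C :: ('g, 'b) compactification) (R :: ('g, 'r) compactification).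
        G_compactification G T C \<and> roelcke_compactification G T R \<longrightarrow>
        comp_le T (graph_compactification G T C) R \<and>
        (comp_le T R C \<longrightarrow> comp_eq T (graph_compactification G T C) R)) \<and>
     (\<forall>C :: ('g, 'b) compactification. G_lr_compactification G T C \<longrightarrow>
        (comp_eq T (graph_compactification G T C) C \<longleftrightarrow>
         (\<forall>u\<in>subspace_uniformity G C. \<exists>v\<in>subspace_uniformity G C.
            \<forall>g\<in>carrier G. \<forall>h\<in>carrier G. g \<in> star h v \<longrightarrow>
              (\<forall>y\<in>carrier G. \<exists>x\<in>carrier G. y \<in> star x u \<and> h \<otimes>\<^bsub>G\<^esub> y \<in> star (g \<otimes>\<^bsub>G\<^esub> x) u) \<and>
              (\<forall>x\<in>carrier G. \<exists>y\<in>carrier G. x \<in> star y u \<and> g \<otimes>\<^bsub>G\<^esub> x \<in> star (h \<otimes>\<^bsub>G\<^esub> y) u))))"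
proof -
  interpret topological_group G T by fact
  show ?thesis
    by (intro conjI allI impI; (elim conjE)?)
      (rule G_star_graph_compactification graph_compactification_mono
        lr_le_graph_compactification graph_compactification_le_roelcke
        graph_compactification_eq_roelcke graph_compactification_eq_iff; assumption)+
qed

end
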